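(* For all $k\ge 1$, the problem $\mathsf{CSP}[\mathsf{coverwidth}\le k]$ is decidable in polynomial time by the projective $k$-consistency algorithm. In particular, on an instance of $\mathsf{CSP}[\mathsf{coverwidth}\le k]$, the projective $k$-consistency algorithm reports an inconsistency if and only if the instance is not satisfiable.
   Context: A CSP instance is a pair $\mathbf{A},\mathbf{B}$ of finite relational structures over the same finite relational signature; it is satisfiable if there is a homomorphism from $\mathbf{A}$ to $\mathbf{B}$ (a map $h:A\to B$ with $(h(a_1),\ldots,h(a_r))\in R^{\mathbf{B}}$ for all $(a_1,\ldots,a_r)\in R^{\mathbf{A}}$). $H(\mathbf{A})$ is the hypergraph on $A$ with a hyperedge $\{a_1,\ldots,a_r\}$ per tuple of any relation of $\mathbf{A}$. A $k$-union is a union of $k$ hyperedges (the empty set being the $0$-union); the weight of $X\subseteq A$ is the least $k\ge0$ with $X\cap\bigcup_e e$ contained in a $k$-union. A tree decomposition of $H(\mathbf{A})$ is a tree with bags $X_i\subseteq A$ covering $A$, each hyperedge inside some bag, and for each vertex the bags containing it forming a connected subtree; its weight is its maximal bag weight; the coverwidth of $\mathbf{A}$ is the minimal weight of a tree decomposition. $\mathsf{CSP}[\mathsf{coverwidth}\le k]$ is the CSP restricted to instances $\mathbf{A},\mathbf{B}$ with $\mathbf{A}$ of coverwidth $\le k$. A projective homomorphism from $\mathbf{A}$ to $\mathbf{B}$ is a partial function $h$ from $A$ to $B$ such that for every $R$ and $(a_1,\ldots,a_r)\in R^{\mathbf{A}}$ there is $(b_1,\ldots,b_r)\in R^{\mathbf{B}}$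 with $h(a_i)=b_i$ for all $a_i\in\mathsf{dom}(h)$. The projective $k$-consistency algorithm on $\mathbf{A},\mathbf{B}$: form $\mathbf{A}',\mathbf{B}'$ with universes $A,B$ and a relation symbol $R_U$ for each $k$-union $U$ over $\mathbf{A}$, where $R_U^{\mathbf{A}'}$ contains only the tuple $(u_1,\ldots,u_m)$ listing $U$ in a fixed order and $R_U^{\mathbf{B}'}$ contains all $(b_1,\ldots,b_m)$ such that $u_i\mapsto b_i$ is a projective homomorphism from $\mathbf{A}$ to $\mathbf{B}$; then repeatedly remove any $\mathbf{B}'$-tuple $(b_1,\ldots,b_m)\in R_U^{\mathbf{B}'}$ for which $u_i\mapsto b_i$ is not a projective homomorphism from $\mathbf{A}'$ to $\mathbf{B}'$, until no change; report an inconsistency iff no $\mathbf{B}'$-tuples remain.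
   Formalization: Universes are assumed nonempty and, for correctness, A must have at least one hyperedge: otherwise no k-union exists for k ≥ 1, so the algorithm reports an inconsistency on satisfiable instances. The k hyperedges of a k-union need not be distinct. *)

theory Defs
  imports "HOL-Computational_Algebra.Polynomial"
begin

section \<open>Relational structures and the constraint satisfaction problem\<close>

record 's signature =
  symbols :: "'s set"
  arity :: "'s \<Rightarrow> nat"

text \<open>The interpretation \<^term>\<open>rel\<close> is only relevant on the symbols of the signature at hand.\<close>

record ('s, 'a) rel_structure =
  universe :: "'a set"
  rel :: "'s \<Rightarrow> 'a list set"

definition finite_structure :: "'s signature \<Rightarrow> ('s, 'a) rel_structure \<Rightarrow> bool" where
  "finite_structure \<sigma> A \<longleftrightarrow>
     finite (symbols \<sigma>) \<and> finite (universe A) \<and> universe A \<noteq> {} \<and>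
     (\<forall>R\<in>symbols \<sigma>. \<forall>t\<in>rel A R. length t = arity \<sigma> R \<and> set t \<subseteq> universe A)"

definition csp_instance ::
  "'s signature \<Rightarrow> ('s, 'a) rel_structure \<Rightarrow> ('s, 'b) rel_structure \<Rightarrow> bool" where
  "csp_instance \<sigma> A B \<longleftrightarrow> finite_structure \<sigma> A \<and> finite_structure \<sigma> B"

definition homomorphism ::
  "'s signature \<Rightarrow> ('s, 'a) rel_structure \<Rightarrow> ('s, 'b) rel_structure \<Rightarrow> ('a \<Rightarrow> 'b) \<Rightarrow> bool" where
  "homomorphism \<sigma> A B h \<longleftrightarrow>
     h ` universe A \<subseteq> universe B \<and> (\<forall>R\<in>symbols \<sigma>. \<forall>t\<in>rel A R. map h t \<in> rel B R)"

definition satisfiable ::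
  "'s signature \<Rightarrow> ('s, 'a) rel_structure \<Rightarrow> ('s, 'b) rel_structure \<Rightarrow> bool" where
  "satisfiable \<sigma> A B \<longleftrightarrow> (\<exists>h. homomorphism \<sigma> A B h)"


section \<open>Coverwidth\<close>

definition hyperedges :: "'s signature \<Rightarrow> ('s, 'a) rel_structure \<Rightarrow> 'a set set" where
  "hyperedges \<sigma> A = {set t | t R. R \<in> symbols \<sigma> \<and> t \<in> rel A R}"

text \<open>The \<^term>\<open>k\<close> hyperedges need not be distinct; for \<^term>\<open>k = 0\<close> this yields just the
  empty set.\<close>

definition k_unions :: "nat \<Rightarrow> 's signature \<Rightarrow> ('s, 'a) rel_structure \<Rightarrow> 'a set set" where
  "k_unions k \<sigma> A = {\<Union>(set es) | es. length es = k \<and> set es \<subseteq> hyperedges \<sigma> A}"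

definition weight :: "'s signature \<Rightarrow> ('s, 'a) rel_structure \<Rightarrow> 'a set \<Rightarrow> nat" where
  "weight \<sigma> A X = (LEAST k. \<exists>U\<in>k_unions k \<sigma> A. X \<inter> \<Union>(hyperedges \<sigma> A) \<subseteq> U)"

text \<open>Trees are finite undirected graphs, given by a node set and a symmetric irreflexive set of
  edges.\<close>

definition is_tree :: "'n set \<Rightarrow> ('n \<times> 'n) set \<Rightarrow> bool" where
  "is_tree N E \<longleftrightarrow>
     finite N \<and> N \<noteq> {} \<and> E \<subseteq> N \<times> N \<and> sym E \<and> irrefl E \<and>
     (\<forall>u\<in>N. \<forall>v\<in>N. (u, v) \<in> E\<^sup>*) \<and>
     \<not> (\<exists>c. length c \<ge> 3 \<and> distinct c \<and> successively (\<lambda>u v. (u, v) \<in> E) c \<and>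
          (last c, hd c) \<in> E)"

definition connected_in :: "('n \<times> 'n) set \<Rightarrow> 'n set \<Rightarrow> bool" where
  "connected_in E S \<longleftrightarrow> (\<forall>u\<in>S. \<forall>v\<in>S. (u, v) \<in> (E \<inter> S \<times> S)\<^sup>*)"

definition tree_decomposition ::
  "'s signature \<Rightarrow> ('s, 'a) rel_structure \<Rightarrow> 'n set \<Rightarrow> ('n \<times> 'n) set \<Rightarrow> ('n \<Rightarrow> 'a set) \<Rightarrow> bool" where
  "tree_decomposition \<sigma> A N E X \<longleftrightarrow>
     is_tree N E \<and>
     (\<Union>i\<in>N. X i) = universe A \<and>
     (\<forall>e\<in>hyperedges \<sigma> A. \<exists>i\<in>N. e \<subseteq> X i) \<and>
     (\<forall>v\<in>universe A. connected_in E {i \<in> N. v \<in> X i})"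

definition decomposition_weight ::
  "'s signature \<Rightarrow> ('s, 'a) rel_structure \<Rightarrow> 'n set \<Rightarrow> ('n \<Rightarrow> 'a set) \<Rightarrow> nat" where
  "decomposition_weight \<sigma> A N X = Max ((\<lambda>i. weight \<sigma> A (X i)) ` N)"

text \<open>As trees are finite, taking natural numbers as their nodes is no restriction.\<close>

definition coverwidth :: "'s signature \<Rightarrow> ('s, 'a) rel_structure \<Rightarrow> nat" where
  "coverwidth \<sigma> A =
     (LEAST w. \<exists>(N :: nat set) E X.
        tree_decomposition \<sigma> A N E X \<and> decomposition_weight \<sigma> A N X = w)"


section \<open>The projective k-consistency algorithm\<close>

definition projective_hom ::
  "'s signature \<Rightarrow> ('s, 'a) rel_structure \<Rightarrow> ('s, 'b) rel_structure \<Rightarrow> ('a \<rightharpoonup> 'b) \<Rightarrow> bool" where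
  "projective_hom \<sigma> A B h \<longleftrightarrow>
     dom h \<subseteq> universe A \<and> ran h \<subseteq> universe B \<and>
     (\<forall>R\<in>symbols \<sigma>. \<forall>t\<in>rel A R. \<exists>s\<in>rel B R.
        length s = length t \<and> (\<forall>i<length t. t ! i \<in> dom h \<longrightarrow> h (t ! i) = Some (s ! i)))"

definition listing :: "'a set \<Rightarrow> 'a list" where
  "listing U = (SOME us. distinct us \<and> set us = U)"

definition tuple_map :: "'a set \<Rightarrow> 'b list \<Rightarrow> 'a \<rightharpoonup> 'b" where
  "tuple_map U bs = map_of (zip (listing U) bs)"

text \<open>The symbols \<open>R\<^sub>U\<close> of the derived instance are represented by the k-unions \<open>U\<close> themselves.\<close>

definition union_signature ::
  "nat \<Rightarrow> 's signature \<Rightarrow> ('s, 'a) rel_structure \<Rightarrow> 'a set signature" where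
  "union_signature k \<sigma> A = \<lparr>symbols = k_unions k \<sigma> A, arity = card\<rparr>"

definition union_left :: "('s, 'a) rel_structure \<Rightarrow> ('a set, 'a) rel_structure" where
  "union_left A = \<lparr>universe = universe A, rel = (\<lambda>U. {listing U})\<rparr>"

definition union_right ::
  "'s signature \<Rightarrow> ('s, 'a) rel_structure \<Rightarrow> ('s, 'b) rel_structure \<Rightarrow> ('a set, 'b) rel_structure" where
  "union_right \<sigma> A B =
     \<lparr>universe = universe B,
      rel = (\<lambda>U. {bs. length bs = length (listing U) \<and> set bs \<subseteq> universe B \<and>
                       projective_hom \<sigma> A B (tuple_map U bs)})\<rparr>"

text \<open>One removal turns the current right-hand structure \<open>S\<close> into \<open>S'\<close>.\<close>

definition removal ::
  "nat \<Rightarrow> 's signature \<Rightarrow> ('s, 'a) rel_structure \<Rightarrow>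
     ('a set, 'b) rel_structure \<Rightarrow> ('a set, 'b) rel_structure \<Rightarrow> bool" where
  "removal k \<sigma> A S S' \<longleftrightarrow>
     (\<exists>U\<in>k_unions k \<sigma> A. \<exists>bs\<in>rel S U.
        \<not> projective_hom (union_signature k \<sigma> A) (union_left A) S (tuple_map U bs) \<and>
        S' = S\<lparr>rel := (rel S)(U := rel S U - {bs})\<rparr>)"

text \<open>The order of the removals is not prescribed; \<open>ex1_pkc_final\<close> below shows that it does not
  influence the result.\<close>

definition pkc_final ::
  "nat \<Rightarrow> 's signature \<Rightarrow> ('s, 'a) rel_structure \<Rightarrow> ('s, 'b) rel_structure \<Rightarrow>
     ('a set, 'b) rel_structure \<Rightarrow> bool" where
  "pkc_final k \<sigma> A B S \<longleftrightarrow>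
     (removal k \<sigma> A)\<^sup>*\<^sup>* (union_right \<sigma> A B) S \<and> \<not> (\<exists>S'. removal k \<sigma> A S S')"

definition reports_inconsistency ::
  "nat \<Rightarrow> 's signature \<Rightarrow> ('s, 'a) rel_structure \<Rightarrow> ('s, 'b) rel_structure \<Rightarrow> bool" where
  "reports_inconsistency k \<sigma> A B \<longleftrightarrow>
     (\<exists>S. pkc_final k \<sigma> A B S \<and> (\<forall>U\<in>k_unions k \<sigma> A. rel S U = {}))"

lemma projective_hom_mono:
  assumes "projective_hom \<sigma> A S h" "universe S = universe T"
    and "\<And>R. R \<in> symbols \<sigma> \<Longrightarrow> rel S R \<subseteq> rel T R"
  shows "projective_hom \<sigma> A T h"
  using assms unfolding projective_hom_def by (metis subsetD)

lemma removal_upper: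
  assumes "(removal k \<sigma> A)\<^sup>*\<^sup>* T0 T" "\<not> (\<exists>S'. removal k \<sigma> A S S')"
    and "universe S = universe T0" "\<And>U. rel S U \<subseteq> rel T0 U"
  shows "universe S = universe T \<and> (\<forall>U. rel S U \<subseteq> rel T U)"
  using assms(1)
proof (induction rule: rtranclp_induct)
  case base
  then show ?case using assms by blast
next
  case (step T T')
  then obtain U bs where U: "U \<in> k_unions k \<sigma> A" "bs \<in> rel T U"
    and bad: "\<not> projective_hom (union_signature k \<sigma> A) (union_left A) T (tuple_map U bs)"
    and T': "T' = T\<lparr>rel := (rel T)(U := rel T U - {bs})\<rparr>"
    unfolding removal_def by blast
  have "\<not> projective_hom (union_signature k \<sigma> A) (union_left A) S (tuple_map U bs)"
    using bad projective_hom_mono[of _ _ S _ T] step.IH by blast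
  hence "bs \<notin> rel S U"
    using assms(2) U(1) unfolding removal_def by blast
  then show ?case
    using step.IH T' by auto
qed

lemma removal_lower:
  assumes "(removal k \<sigma> A)\<^sup>*\<^sup>* T0 T"
  shows "universe T = universe T0 \<and> (\<forall>U. rel T U \<subseteq> rel T0 U)"
  using assms
proof (induction rule: rtranclp_induct)
  case (step T T')
  have "universe T' = universe T \<and> (\<forall>U. rel T' U \<subseteq> rel T U)"
    using step.hyps(2) unfolding removal_def by (auto split: if_splits)
  then show ?case
    using step.IH by (metis order_trans)
qed simp

lemma finite_k_unions:
  assumes "finite_structure \<sigma> A"
  shows "finite (k_unions k \<sigma> A)"
proof -
  have "hyperedges \<sigma> A \<subseteq> Pow (universe A)"
    using assms unfolding hyperedges_def finite_structure_def by blast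
  hence "k_unions k \<sigma> A \<subseteq> Pow (universe A)"
    unfolding k_unions_def by blast
  thus ?thesis
    using assms finite_subset unfolding finite_structure_def by blast
qed

lemma removal_terminates:
  assumes "finite (k_unions k \<sigma> A)" "\<And>U. U \<in> k_unions k \<sigma> A \<Longrightarrow> finite (rel T U)"
  shows "\<exists>S. (removal k \<sigma> A)\<^sup>*\<^sup>* T S \<and> \<not> (\<exists>S'. removal k \<sigma> A S S')"
  using assms(2)
proof (induction "\<Sum>U\<in>k_unions k \<sigma> A. card (rel T U)" arbitrary: T rule: less_induct)
  case less
  show ?case
  proof (cases "\<exists>T'. removal k \<sigma> A T T'")
    case False
    then show ?thesis by blast
  next
    case True
    then obtain T' U bs where r: "removal k \<sigma> A T T'" and U: "U \<in> k_unions k \<sigma> A" "bs \<in> rel T U"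
      and T': "T' = T\<lparr>rel := (rel T)(U := rel T U - {bs})\<rparr>"
      unfolding removal_def by blast
    have sub: "rel T' V \<subseteq> rel T V" for V
      using T' by auto
    have fin: "finite (rel T' V)" if "V \<in> k_unions k \<sigma> A" for V
      using that less.prems sub finite_subset by blast
    have "card (rel T' U) < card (rel T U)"
      using card_Diff1_less[OF less.prems[OF U(1)] U(2)] T' by simp
    hence "(\<Sum>U\<in>k_unions k \<sigma> A. card (rel T' U)) < (\<Sum>U\<in>k_unions k \<sigma> A. card (rel T U))"
      using U assms(1) less.prems sub
      by (intro sum_strict_mono_ex1) (auto intro: card_mono)
    from less.hyps[OF this fin] show ?thesis
      using r by (meson converse_rtranclp_into_rtranclp)
  qed
qed

lemma ex1_pkc_final:
  assumes "csp_instance \<sigma> A B"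
  shows "\<exists>!S. pkc_final k \<sigma> A B S"
proof (rule ex_ex1I)
  have "finite (rel (union_right \<sigma> A B) U)" for U
  proof (rule finite_subset)
    show "rel (union_right \<sigma> A B) U
        \<subseteq> {bs. set bs \<subseteq> universe B \<and> length bs = length (listing U)}"
      by (auto simp: union_right_def)
    show "finite {bs. set bs \<subseteq> universe B \<and> length bs = length (listing U)}"
      using assms by (intro finite_lists_length_eq) (simp add: csp_instance_def finite_structure_def)
  qed
  thus "\<exists>S. pkc_final k \<sigma> A B S"
    using removal_terminates[OF finite_k_unions] assms
    unfolding pkc_final_def csp_instance_def by blast
next
  fix S T
  assume "pkc_final k \<sigma> A B S" "pkc_final k \<sigma> A B T"
  hence S: "(removal k \<sigma> A)\<^sup>*\<^sup>* (union_right \<sigma> A B) S" "\<not> (\<exists>S'. removal k \<sigma> A S S')"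
    and T: "(removal k \<sigma> A)\<^sup>*\<^sup>* (union_right \<sigma> A B) T" "\<not> (\<exists>S'. removal k \<sigma> A T S')"
    by (auto simp: pkc_final_def)
  have "universe S = universe T \<and> (\<forall>U. rel S U \<subseteq> rel T U)"
    using removal_upper[OF T(1) S(2)] removal_lower[OF S(1)] by blast
  moreover have "\<forall>U. rel T U \<subseteq> rel S U"
    using removal_upper[OF S(1) T(2)] removal_lower[OF T(1)] by blast
  ultimately have "universe S = universe T" "rel S = rel T"
    by blast+
  thus "S = T"
    by simp
qed


section \<open>Polynomial time\<close>

text \<open>The machine model is the WHILE language of Jones (Computability and Complexity from a
  Programming Perspective, 1997) without its built-in equality test and with an added
  conditional: imperative programs over binary trees with unit-cost operations. Jones shows that
  polynomial time in his models agrees with polynomial time on Turing machines. Sharing of subtrees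
  makes unit cost realistic: each step allocates boundedly many cells.\<close>

datatype dtree = Leaf | Node dtree dtree

fun left_child :: "dtree \<Rightarrow> dtree" where
  "left_child Leaf = Leaf"
| "left_child (Node l r) = l"

fun right_child :: "dtree \<Rightarrow> dtree" where
  "right_child Leaf = Leaf"
| "right_child (Node l r) = r"

datatype expr = Var nat | Const_Leaf | Mk_Node expr expr | Left expr | Right expr

fun expr_value :: "expr \<Rightarrow> (nat \<Rightarrow> dtree) \<Rightarrow> dtree" where
  "expr_value (Var x) s = s x"
| "expr_value Const_Leaf s = Leaf"
| "expr_value (Mk_Node e1 e2) s = Node (expr_value e1 s) (expr_value e2 s)"
| "expr_value (Left e) s = left_child (expr_value e s)"
| "expr_value (Right e) s = right_child (expr_value e s)"

fun expr_cost :: "expr \<Rightarrow> nat" where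
  "expr_cost (Var x) = 1"
| "expr_cost Const_Leaf = 1"
| "expr_cost (Mk_Node e1 e2) = expr_cost e1 + expr_cost e2 + 1"
| "expr_cost (Left e) = expr_cost e + 1"
| "expr_cost (Right e) = expr_cost e + 1"

datatype com =
    Assign nat expr
  | Seq com com
  | If expr com com
  | While expr com

text \<open>\<^term>\<open>Leaf\<close> counts as false and every other tree as true. In \<open>exec c s t s'\<close> the
  number \<open>t\<close> is the running time.\<close>

inductive exec :: "com \<Rightarrow> (nat \<Rightarrow> dtree) \<Rightarrow> nat \<Rightarrow> (nat \<Rightarrow> dtree) \<Rightarrow> bool" where
  exec_Assign:
    "exec (Assign x e) s (expr_cost e + 1) (s(x := expr_value e s))"
| exec_Seq:
    "exec c1 s t1 s' \<Longrightarrow> exec c2 s' t2 s'' \<Longrightarrow> exec (Seq c1 c2) s (t1 + t2) s''"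
| exec_If_true:
    "expr_value e s \<noteq> Leaf \<Longrightarrow> exec c1 s t s' \<Longrightarrow> exec (If e c1 c2) s (expr_cost e + 1 + t) s'"
| exec_If_false:
    "expr_value e s = Leaf \<Longrightarrow> exec c2 s t s' \<Longrightarrow> exec (If e c1 c2) s (expr_cost e + 1 + t) s'"
| exec_While_true:
    "expr_value e s \<noteq> Leaf \<Longrightarrow> exec c s t1 s' \<Longrightarrow> exec (While e c) s' t2 s'' \<Longrightarrow>
     exec (While e c) s (expr_cost e + 1 + t1 + t2) s''"
| exec_While_false:
    "expr_value e s = Leaf \<Longrightarrow> exec (While e c) s (expr_cost e + 1) s"

definition runs :: "com \<Rightarrow> dtree \<Rightarrow> nat \<Rightarrow> dtree \<Rightarrow> bool" where
  "runs c x t y \<longleftrightarrow> (\<exists>s'. exec c ((\<lambda>_. Leaf)(0 := x)) t s' \<and> s' 0 = y)"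

definition polynomial_time_on :: "com \<Rightarrow> dtree set \<Rightarrow> bool" where
  "polynomial_time_on c D \<longleftrightarrow>
     (\<exists>p :: nat poly. \<forall>x\<in>D. \<exists>t y. runs c x t y \<and> t \<le> poly p (size x))"

definition accepts :: "com \<Rightarrow> dtree \<Rightarrow> bool" where
  "accepts c x \<longleftrightarrow> (\<exists>t y. runs c x t y \<and> y \<noteq> Leaf)"


section \<open>Instances as input data\<close>

text \<open>An input consists of the two universes, followed for each relation symbol by its arity, its
  tuples in the left structure and its tuples in the right structure. The symbols are the
  positions in that list. All listings may be in any order.\<close>

type_synonym csp_input =
  "nat list \<times> nat list \<times> (nat \<times> nat list list \<times> nat list list) list"

fun input_signature :: "csp_input \<Rightarrow> nat signature" where
  "input_signature (as, bs, rs) =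
     \<lparr>symbols = {..<length rs}, arity = (\<lambda>i. fst (rs ! i))\<rparr>"

fun input_left :: "csp_input \<Rightarrow> (nat, nat) rel_structure" where
  "input_left (as, bs, rs) =
     \<lparr>universe = set as, rel = (\<lambda>i. set (fst (snd (rs ! i))))\<rparr>"

fun input_right :: "csp_input \<Rightarrow> (nat, nat) rel_structure" where
  "input_right (as, bs, rs) =
     \<lparr>universe = set bs, rel = (\<lambda>i. set (snd (snd (rs ! i))))\<rparr>"

definition csp_inputs :: "csp_input set" where
  "csp_inputs = {I. csp_instance (input_signature I) (input_left I) (input_right I)}"

fun enc_list :: "('a \<Rightarrow> dtree) \<Rightarrow> 'a list \<Rightarrow> dtree" where
  "enc_list f [] = Leaf"
| "enc_list f (x # xs) = Node (f x) (enc_list f xs)"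

fun enc_pair :: "('a \<Rightarrow> dtree) \<Rightarrow> ('b \<Rightarrow> dtree) \<Rightarrow> 'a \<times> 'b \<Rightarrow> dtree" where
  "enc_pair f g (x, y) = Node (f x) (g y)"

text \<open>Binary notation, least significant bit first.\<close>

fun enc_nat :: "nat \<Rightarrow> dtree" where
  "enc_nat n =
     (if n = 0 then Leaf
      else Node (if odd n then Node Leaf Leaf else Leaf) (enc_nat (n div 2)))"

declare enc_nat.simps [simp del]

definition enc_input :: "csp_input \<Rightarrow> dtree" where
  "enc_input =
     enc_pair (enc_list enc_nat)
       (enc_pair (enc_list enc_nat)
         (enc_list (enc_pair enc_nat
           (enc_pair (enc_list (enc_list enc_nat)) (enc_list (enc_list enc_nat))))))"

text \<open>A program executes the algorithm if it outputs a list of the tuples remaining at the end.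
  A tuple \<open>(b\<^sub>1, \<dots>, b\<^sub>m)\<close> of \<open>R\<^sub>U\<close> is output as an association list for
  \<open>u\<^sub>i \<mapsto> b\<^sub>i\<close>. As the empty list is encoded by \<^term>\<open>Leaf\<close>, rejecting is the same as
  reporting an inconsistency.\<close>

definition remaining_maps ::
  "nat \<Rightarrow> 's signature \<Rightarrow> ('s, 'a) rel_structure \<Rightarrow> ('a set, 'b) rel_structure \<Rightarrow> ('a \<rightharpoonup> 'b) set" where
  "remaining_maps k \<sigma> A S = {tuple_map U bs | U bs. U \<in> k_unions k \<sigma> A \<and> bs \<in> rel S U}"

definition executes_pkc :: "nat \<Rightarrow> com \<Rightarrow> bool" where
  "executes_pkc k c \<longleftrightarrow>
     (\<forall>I\<in>csp_inputs. \<exists>t L S.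
        runs c (enc_input I) t (enc_list (enc_list (enc_pair enc_nat enc_nat)) L) \<and>
        pkc_final k (input_signature I) (input_left I) (input_right I) S \<and>
        map_of ` set L = remaining_maps k (input_signature I) (input_left I) S)"

text \<open>Left structures without any tuple are excluded: for \<^term>\<open>k \<ge> 1\<close> they have no k-union, so
  the algorithm reports an inconsistency although every map is a homomorphism.\<close>

definition csp_coverwidth_inputs :: "nat \<Rightarrow> csp_input set" where
  "csp_coverwidth_inputs k =
     {I \<in> csp_inputs. hyperedges (input_signature I) (input_left I) \<noteq> {} \<and>
        coverwidth (input_signature I) (input_left I) \<le> k}"

definition input_satisfiable :: "csp_input \<Rightarrow> bool" where
  "input_satisfiable I \<longleftrightarrow> satisfiable (input_signature I) (input_left I) (input_right I)"

end

theory Submission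
  imports Defs
begin

text \<open>The maps that survive the algorithm form the greatest stable set of projective
  homomorphisms on k-unions, where stable means that each map of the set has, for every k-union,
  a compatible map of the set on that k-union. The restrictions of a homomorphism form a stable
  set. Conversely, if the surviving set is nonempty and each bag of a tree decomposition is covered
  by a k-union, one chooses surviving maps for these k-unions along the tree, compatible across each
  edge; by the connectedness condition they glue to a homomorphism.

  For the running time, every projective homomorphism on a union of k hyperedges extends a choice of
  k pairs of a tuple of the left structure and a tuple of the right structure. Hence there are
  polynomially many candidates, and the greatest stable set is reached after as many rounds of
  simultaneous removals as there are candidates. The existence of the program follows from closure
  properties of the polynomial-time functions on trees, where a tree is read as the list of left
  subtrees along its right spine.\<close>

section \<open>Polynomial-time functions on trees\<close>

text \<open>The algorithm removes single tuples in an arbitrary order, the program prunes in rounds.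
  The two are never compared step by step: each is shown to end at the greatest stable set. The
  obstacle for the running time is iteration, since repeating a polynomial-time function as often as
  the input is long may produce trees of exponential size. Loops therefore enter only as folds whose
  step enlarges the accumulator by an amount that does not depend on the accumulator. The list
  operations have this form, and pruning does not enlarge its list at all. The algorithm is written
  twice: on typed lists, where it is compared with the structures, and on untyped trees, where the
  closure properties apply. Equations on encodings connect the two versions, so that no program text
  is ever inspected. In the gluing, the k-unions that cover the bags may overlap outside the bags,
  where connectedness says nothing. Agreement of the chosen maps is therefore claimed only at
  vertices common to both bags.\<close>

inductive_cases exec_AssignE: "exec (Assign x e) s t s'"
inductive_cases exec_SeqE: "exec (Seq c d) s t s'"
inductive_cases exec_IfE: "exec (If e c d) s t s'"
inductive_cases exec_WhileE: "exec (While e c) s t s'"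

text \<open>\<open>accepts\<close> asks for some run with a nonempty output, so a run that rejects
  refutes acceptance only if runs are unique.\<close>

lemma exec_deterministic:
  "exec c s t s' \<Longrightarrow> exec c s u s'' \<Longrightarrow> t = u \<and> s' = s''"
proof (induction arbitrary: u s'' rule: exec.induct)
  case exec_Assign
  then show ?case by (auto elim: exec_AssignE)
next
  case (exec_Seq c1 s t1 s' c2 t2 s1)
  from exec_Seq.prems obtain v w r where r: "u = v + w" "exec c1 s v r" "exec c2 r w s''"
    by (rule exec_SeqE)
  with exec_Seq.IH(1)[OF r(2)] exec_Seq.IH(2)[of w s''] show ?case by simp
next
  case (exec_If_true e s c1 t s' c2)
  from exec_If_true.prems obtain v where "u = Suc (expr_cost e + v)" "exec c1 s v s''"
    by (rule exec_IfE) (simp_all add: exec_If_true.hyps)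
  with exec_If_true.IH[of v s''] show ?case by simp
next
  case (exec_If_false e s c2 t s' c1)
  from exec_If_false.prems obtain v where "u = Suc (expr_cost e + v)" "exec c2 s v s''"
    by (rule exec_IfE) (simp_all add: exec_If_false.hyps)
  with exec_If_false.IH[of v s''] show ?case by simp
next
  case (exec_While_true e s c t1 s' t2 s1)
  from exec_While_true.prems obtain v w r
    where r: "u = Suc (expr_cost e + v + w)" "exec c s v r" "exec (While e c) r w s''"
    by (rule exec_WhileE) (simp_all add: exec_While_true.hyps)
  with exec_While_true.IH(1)[OF r(2)] exec_While_true.IH(2)[of w s''] show ?case by simp
next
  case (exec_While_false e s c)
  from exec_While_false.prems show ?case
    by (rule exec_WhileE) (simp_all add: exec_While_false.hyps)
qed

section \<open>Polynomial bounds in the size of a tree\<close>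

lemma poly_nat_mono:
  fixes p :: "nat poly"
  assumes "m \<le> n"
  shows "poly p m \<le> poly p n"
proof (induction p)
  case (pCons a p)
  \<comment> \<open>Coefficients are natural numbers, so each stage of the Horner scheme is
    monotone.\<close>
  have "m * poly p m \<le> n * poly p n"
    using assms pCons.IH by (rule mult_le_mono)
  then show ?case by simp
qed simp

text \<open>The bound is required on all trees and not only on encodings, so intermediate results of
  a composition need no well-formedness condition.\<close>

definition poly_bounded :: "(dtree \<Rightarrow> nat) \<Rightarrow> bool" where
  "poly_bounded f \<longleftrightarrow> (\<exists>p :: nat poly. \<forall>x. f x \<le> poly p (size x))"

lemma poly_bounded_le:
  assumes "poly_bounded g" "\<And>x. f x \<le> g x"
  shows "poly_bounded f"
  using assms unfolding poly_bounded_def by (meson order_trans)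

lemma poly_bounded_const: "poly_bounded (\<lambda>x. c)"
  unfolding poly_bounded_def by (rule exI[of _ "[:c:]"]) simp

lemma poly_bounded_size: "poly_bounded size"
  unfolding poly_bounded_def by (rule exI[of _ "[:0, 1:]"]) simp

lemma poly_bounded_add:
  assumes "poly_bounded f" "poly_bounded g"
  shows "poly_bounded (\<lambda>x. f x + g x)"
proof -
  obtain p q :: "nat poly" where "\<And>x. f x \<le> poly p (size x)" "\<And>x. g x \<le> poly q (size x)"
    using assms unfolding poly_bounded_def by blast
  then have "\<And>x. f x + g x \<le> poly (p + q) (size x)"
    by (simp add: add_mono)
  then show ?thesis unfolding poly_bounded_def by blast
qed

lemma poly_bounded_mult:
  assumes "poly_bounded f" "poly_bounded g"
  shows "poly_bounded (\<lambda>x. f x * g x)"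
proof -
  obtain p q :: "nat poly" where "\<And>x. f x \<le> poly p (size x)" "\<And>x. g x \<le> poly q (size x)"
    using assms unfolding poly_bounded_def by blast
  then have "\<And>x. f x * g x \<le> poly (p * q) (size x)"
    by (simp add: mult_mono)
  then show ?thesis unfolding poly_bounded_def by blast
qed

lemma poly_bounded_poly:
  fixes p :: "nat poly"
  assumes "poly_bounded f"
  shows "poly_bounded (\<lambda>x. poly p (f x))"
proof -
  obtain q :: "nat poly" where "\<And>x. f x \<le> poly q (size x)"
    using assms unfolding poly_bounded_def by blast
  then have "\<And>x. poly p (f x) \<le> poly (pcompose p q) (size x)"
    by (simp add: poly_pcompose poly_nat_mono)
  then show ?thesis unfolding poly_bounded_def by blast
qed

lemma poly_bounded_compose:
  assumes "poly_bounded f" "poly_bounded (\<lambda>x. size (g x))"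
  shows "poly_bounded (\<lambda>x. f (g x))"
proof -
  obtain p :: "nat poly" where "\<And>x. f x \<le> poly p (size x)"
    using assms unfolding poly_bounded_def by blast
  with poly_bounded_poly[OF assms(2)] show ?thesis
    by (rule poly_bounded_le)
qed

lemmas poly_bounded_intros =
  poly_bounded_const poly_bounded_size poly_bounded_add poly_bounded_mult

text \<open>Variable 0 holds a stack of trees, of which a program touches only the top. No other
  variable is needed, so programs compose without any renaming.\<close>

definition computes :: "com \<Rightarrow> (dtree \<Rightarrow> dtree) \<Rightarrow> (dtree \<Rightarrow> nat) \<Rightarrow> bool" where
  "computes c f T \<longleftrightarrow>
     (\<forall>x r s. s 0 = Node x r \<longrightarrow> (\<exists>t \<le> T x. exec c s t (s(0 := Node (f x) r))))"

text \<open>The output size has to be bounded separately: thanks to sharing, a program may double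
  the size of a tree in constant time.\<close>

definition ptime :: "(dtree \<Rightarrow> dtree) \<Rightarrow> bool" where
  "ptime f \<longleftrightarrow> poly_bounded (\<lambda>x. size (f x)) \<and> (\<exists>c T. poly_bounded T \<and> computes c f T)"

lemma ptimeI:
  assumes "poly_bounded (\<lambda>x. size (f x))" "poly_bounded T"
    and "\<And>x r s. s 0 = Node x r \<Longrightarrow> \<exists>t \<le> T x. exec c s t (s(0 := Node (f x) r))"
  shows "ptime f"
  using assms unfolding ptime_def computes_def by blast

lemma computesD:
  assumes "computes c f T" "s 0 = Node x r"
  shows "\<exists>t \<le> T x. exec c s t (s(0 := Node (f x) r))"
  using assms unfolding computes_def by blast

lemma ptime_size: "ptime f \<Longrightarrow> poly_bounded (\<lambda>x. size (f x))"
  by (simp add: ptime_def)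

lemma exec_Assign_eq:
  assumes "s' = s(x := expr_value e s)"
  shows "exec (Assign x e) s (expr_cost e + 1) s'"
  using exec_Assign assms by simp

text \<open>A single assignment replaces the top of the stack. Its cost depends on the expression
  alone and not on the data, hence the constant time bound.\<close>

lemma ptime_expr:
  assumes "\<And>x r s. s 0 = Node x r \<Longrightarrow> expr_value e s = f x"
    and "poly_bounded (\<lambda>x. size (f x))"
  shows "ptime f"
proof (rule ptimeI[OF assms(2) poly_bounded_const])
  fix x r :: dtree and s :: "nat \<Rightarrow> dtree"
  assume s: "s 0 = Node x r"
  have "exec (Assign 0 (Mk_Node e (Right (Var 0)))) s (expr_cost (Mk_Node e (Right (Var 0))) + 1)
      (s(0 := Node (f x) r))"
    by (rule exec_Assign_eq) (simp add: s assms(1))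
  then show "\<exists>t \<le> expr_cost (Mk_Node e (Right (Var 0))) + 1.
      exec (Assign 0 (Mk_Node e (Right (Var 0)))) s t (s(0 := Node (f x) r))"
    by blast
qed

lemma ptime_id: "ptime (\<lambda>x. x)"
  by (rule ptime_expr[where e = "Left (Var 0)"]) (auto intro: poly_bounded_intros)

lemma ptime_const: "ptime (\<lambda>x. c)"
proof -
  \<comment> \<open>The fixed tree \<open>c\<close> is written out node by node as an
    expression.\<close>
  define e where "e = rec_dtree Const_Leaf (\<lambda>l r e1 e2. Mk_Node e1 e2)"
  have "expr_value (e c) s = c" for s
    by (induction c) (simp_all add: e_def)
  then show ?thesis
    by (intro ptime_expr[where e = "e c"] poly_bounded_const)
qed

lemma size_left_child: "size (left_child x) \<le> size x"
  and size_right_child: "size (right_child x) \<le> size x"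
  by (cases x; simp)+

lemma ptime_comp:
  assumes "ptime f" "ptime g"
  shows "ptime (\<lambda>x. f (g x))"
proof -
  obtain c T where T: "poly_bounded T" and "computes c f T"
    using assms(1) unfolding ptime_def by blast
  note c = computesD[OF this(2)]
  obtain d U where U: "poly_bounded U" and "computes d g U"
    using assms(2) unfolding ptime_def by blast
  note d = computesD[OF this(2)]
  show ?thesis
  proof (rule ptimeI)
    show "poly_bounded (\<lambda>x. size (f (g x)))" "poly_bounded (\<lambda>x. U x + T (g x))"
      by (rule poly_bounded_compose[OF ptime_size[OF assms(1)] ptime_size[OF assms(2)]],
          rule poly_bounded_add[OF U poly_bounded_compose[OF T ptime_size[OF assms(2)]]])
    fix x r :: dtree and s :: "nat \<Rightarrow> dtree"
    assume "s 0 = Node x r"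
    from d[of s x r, OF this] obtain t where t: "t \<le> U x" "exec d s t (s(0 := Node (g x) r))" by blast
    from c[of "s(0 := Node (g x) r)" "g x" r, unfolded fun_upd_upd, OF fun_upd_same] obtain u
      where u: "u \<le> T (g x)" "exec c (s(0 := Node (g x) r)) u (s(0 := Node (f (g x)) r))" by blast
    show "\<exists>t\<le>U x + T (g x). exec (Seq d c) s t (s(0 := Node (f (g x)) r))"
      using exec_Seq[OF t(2) u(2)] add_mono[OF t(1) u(1)] by blast
  qed
qed

lemma ptime_left:
  assumes "ptime f"
  shows "ptime (\<lambda>x. left_child (f x))"
proof (rule ptime_comp[OF _ assms])
  show "ptime left_child"
    by (rule ptime_expr[where e = "Left (Left (Var 0))"])
      (simp, rule poly_bounded_le[OF poly_bounded_size size_left_child])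
qed

lemma ptime_right:
  assumes "ptime f"
  shows "ptime (\<lambda>x. right_child (f x))"
proof (rule ptime_comp[OF _ assms])
  show "ptime right_child"
    by (rule ptime_expr[where e = "Right (Left (Var 0))"])
      (simp, rule poly_bounded_le[OF poly_bounded_size size_right_child])
qed

text \<open>A program consumes its argument, so \<open>x\<close> is duplicated first. After the
  first program its result is swapped below the remaining copy, on which the second program runs;
  then both results are joined.\<close>

lemma ptime_Node:
  assumes "ptime f" "ptime g"
  shows "ptime (\<lambda>x. Node (f x) (g x))"
proof -
  obtain c T where T: "poly_bounded T" and "computes c f T"
    using assms(1) unfolding ptime_def by blast
  note c = computesD[OF this(2)]
  obtain d U where U: "poly_bounded U" and "computes d g U"
    using assms(2) unfolding ptime_def by blast
  note d = computesD[OF this(2)]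
  let ?push = "Mk_Node (Left (Var 0)) (Var 0)"
  let ?swap = "Mk_Node (Left (Right (Var 0))) (Mk_Node (Left (Var 0)) (Right (Right (Var 0))))"
  let ?join = "Mk_Node (Mk_Node (Left (Right (Var 0))) (Left (Var 0))) (Right (Right (Var 0)))"
  let ?K = "expr_cost ?push + 1 + (expr_cost ?swap + 1 + (expr_cost ?join + 1))"
  show ?thesis
  proof (rule ptimeI)
    show "poly_bounded (\<lambda>x. size (Node (f x) (g x)))"
      by (rule poly_bounded_le[where g = "\<lambda>x. size (f x) + size (g x) + 1"])
        (intro poly_bounded_intros ptime_size assms, simp)
    show "poly_bounded (\<lambda>x. T x + U x + ?K)"
      using T U by (intro poly_bounded_intros)
    fix x r :: dtree and s :: "nat \<Rightarrow> dtree"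
    assume s: "s 0 = Node x r"
    have 1: "exec (Assign 0 ?push) s (expr_cost ?push + 1) (s(0 := Node x (Node x r)))"
      by (rule exec_Assign_eq) (simp add: s)
    from c[of "s(0 := Node x (Node x r))" x "Node x r"] obtain t where
      2: "t \<le> T x" "exec c (s(0 := Node x (Node x r))) t (s(0 := Node (f x) (Node x r)))" by auto
    have 3: "exec (Assign 0 ?swap) (s(0 := Node (f x) (Node x r))) (expr_cost ?swap + 1)
        (s(0 := Node x (Node (f x) r)))"
      by (rule exec_Assign_eq) simp
    from d[of "s(0 := Node x (Node (f x) r))" x "Node (f x) r"] obtain u where
      4: "u \<le> U x" "exec d (s(0 := Node x (Node (f x) r))) u (s(0 := Node (g x) (Node (f x) r)))"
      by auto
    have 5: "exec (Assign 0 ?join) (s(0 := Node (g x) (Node (f x) r))) (expr_cost ?join + 1)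
        (s(0 := Node (Node (f x) (g x)) r))"
      by (rule exec_Assign_eq) simp
    note exec_Seq[OF 1 exec_Seq[OF 2(2) exec_Seq[OF 3 exec_Seq[OF 4(2) 5]]]]
    moreover have "expr_cost ?push + 1 + (t + (expr_cost ?swap + 1 + (u + (expr_cost ?join + 1))))
      \<le> T x + U x + ?K"
      using 2(1) 4(1) by simp
    ultimately show "\<exists>t \<le> T x + U x + ?K.
        exec (Seq (Assign 0 ?push) (Seq c (Seq (Assign 0 ?swap) (Seq d (Assign 0 ?join))))) s t
          (s(0 := Node (Node (f x) (g x)) r))"
      by blast
  qed
qed

definition truth :: "bool \<Rightarrow> dtree" where
  "truth b = (if b then Node Leaf Leaf else Leaf)"

lemma truth_eq_Leaf [simp]: "truth b = Leaf \<longleftrightarrow> \<not> b"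
  by (simp add: truth_def)

lemma ptime_if:
  assumes "ptime (\<lambda>x. truth (P x))" "ptime f" "ptime g"
  shows "ptime (\<lambda>x. if P x then f x else g x)"
proof -
  obtain b S where S: "poly_bounded S" and "computes b (\<lambda>x. truth (P x)) S"
    using assms(1) unfolding ptime_def by blast
  note b = computesD[OF this(2)]
  obtain c T where T: "poly_bounded T" and "computes c f T"
    using assms(2) unfolding ptime_def by blast
  note c = computesD[OF this(2)]
  obtain d U where U: "poly_bounded U" and "computes d g U"
    using assms(3) unfolding ptime_def by blast
  note d = computesD[OF this(2)]
  let ?push = "Mk_Node (Left (Var 0)) (Var 0)"
  let ?pop = "Assign 0 (Right (Var 0))"
  show ?thesis
  proof (rule ptimeI)
    show "poly_bounded (\<lambda>x. size (if P x then f x else g x))"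
      by (rule poly_bounded_le[where g = "\<lambda>x. size (f x) + size (g x)"])
        (intro poly_bounded_add ptime_size assms, simp)
    \<comment> \<open>20 is a generous bound for the duplication, the test and the removal of the
      truth value.\<close>
    show "poly_bounded (\<lambda>x. S x + (T x + U x) + 20)"
      using S T U by (intro poly_bounded_intros)
    fix x r :: dtree and s :: "nat \<Rightarrow> dtree"
    assume s: "s 0 = Node x r"
    have 1: "exec (Assign 0 ?push) s (expr_cost ?push + 1) (s(0 := Node x (Node x r)))"
      by (rule exec_Assign_eq) (simp add: s)
    from b[of "s(0 := Node x (Node x r))" x "Node x r"] obtain t where
      2: "t \<le> S x"
        "exec b (s(0 := Node x (Node x r))) t (s(0 := Node (truth (P x)) (Node x r)))" by auto
    have 3: "exec ?pop (s(0 := Node (truth (P x)) (Node x r))) (expr_cost (Right (Var 0)) + 1)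
        (s(0 := Node x r))"
      by (rule exec_Assign_eq) simp
    have "\<exists>u \<le> T x + U x. exec (if P x then c else d) (s(0 := Node x r)) u
        (s(0 := Node (if P x then f x else g x) r))"
    proof (cases "P x")
      case True
      from c[of "s(0 := Node x r)" x r, unfolded fun_upd_upd, OF fun_upd_same]
      obtain u where "u \<le> T x" "exec c (s(0 := Node x r)) u (s(0 := Node (f x) r))"
        by blast
      with True show ?thesis by (intro exI[of _ u]) simp
    next
      case False
      from d[of "s(0 := Node x r)" x r, unfolded fun_upd_upd, OF fun_upd_same]
      obtain u where "u \<le> U x" "exec d (s(0 := Node x r)) u (s(0 := Node (g x) r))"
        by blast
      with False show ?thesis by (intro exI[of _ u]) simp
    qed
    then obtain u where 4: "u \<le> T x + U x" "exec (if P x then c else d) (s(0 := Node x r)) u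
        (s(0 := Node (if P x then f x else g x) r))" by blast
    \<comment> \<open>The truth value lies above the saved copy of \<open>x\<close> and is dropped
      inside each branch, after it has been tested.\<close>
    have 5: "exec (If (Left (Var 0)) (Seq ?pop c) (Seq ?pop d))
        (s(0 := Node (truth (P x)) (Node x r)))
        (expr_cost (Left (Var 0)) + 1 + (expr_cost (Right (Var 0)) + 1 + u))
        (s(0 := Node (if P x then f x else g x) r))"
    proof (cases "P x")
      case True
      have "exec c (s(0 := Node x r)) u (s(0 := Node (if P x then f x else g x) r))"
        using 4(2) True by simp
      from exec_If_true[OF _ exec_Seq[OF 3 this], of "Left (Var 0)"] True show ?thesis by simp
    next
      case False
      have "exec d (s(0 := Node x r)) u (s(0 := Node (if P x then f x else g x) r))"
        using 4(2) False by simp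
      from exec_If_false[OF _ exec_Seq[OF 3 this], of "Left (Var 0)"] False show ?thesis by simp
    qed
    show "\<exists>t \<le> S x + (T x + U x) + 20.
        exec (Seq (Assign 0 ?push) (Seq b (If (Left (Var 0)) (Seq ?pop c) (Seq ?pop d)))) s t
          (s(0 := Node (if P x then f x else g x) r))"
      by (rule exI, rule conjI[rotated], rule exec_Seq[OF 1 exec_Seq[OF 2(2) 5]])
        (use 2(1) 4(1) in simp)
  qed
qed

section \<open>Trees as lists, and loops over them\<close>

fun spine :: "dtree \<Rightarrow> dtree list" where
  "spine Leaf = []"
| "spine (Node x y) = x # spine y"

abbreviation tree_of :: "dtree list \<Rightarrow> dtree" where
  "tree_of \<equiv> enc_list (\<lambda>x. x)"

lemma tree_of_spine [simp]: "tree_of (spine x) = x"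
  by (induction x) auto

lemma spine_enc_list [simp]: "spine (enc_list f xs) = map f xs"
  by (induction xs) auto

lemma tree_of_map: "tree_of (map f xs) = enc_list f xs"
  by (induction xs) auto

lemma enc_list_eq_Leaf [simp]: "enc_list f xs = Leaf \<longleftrightarrow> xs = []"
  by (cases xs) auto

lemma length_spine: "length (spine x) \<le> size x"
  by (induction x) auto

lemma size_spine: "y \<in> set (spine x) \<Longrightarrow> size y \<le> size x"
  by (induction x) auto

text \<open>The top of the stack holds a context \<open>c\<close>, the accumulator and the unread
  entries. \<open>pre\<close> puts \<open>c\<close>, the accumulator and the next entry on top for
  the loop body and saves \<open>c\<close> with the remaining entries below; \<open>post\<close>
  reassembles the record. The time \<open>T\<close> is bounded only for the accumulators that occur,
  because over all accumulators it need not be bounded. 60 exceeds the cost of \<open>pre\<close>,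
  \<open>post\<close> and one test, and 10 that of the last test.\<close>

lemma exec_fold_loop:
  fixes c :: dtree and g :: "dtree \<Rightarrow> dtree \<Rightarrow> dtree"
  defines "inp \<equiv> Left (Var 0)"
  defines "pre \<equiv> Mk_Node (Mk_Node (Mk_Node (Left inp) (Left (Right inp))) (Left (Right (Right inp))))
    (Mk_Node (Mk_Node (Left inp) (Right (Right (Right inp)))) (Right (Var 0)))"
  defines "post \<equiv> Mk_Node (Mk_Node (Left (Left (Right (Var 0))))
    (Mk_Node (Left (Var 0)) (Right (Left (Right (Var 0)))))) (Right (Right (Var 0)))"
  assumes body: "\<And>a y r s. s 0 = Node (Node (Node c a) y) r \<Longrightarrow>
      \<exists>t \<le> T a y. exec com s t (s(0 := Node (g a y) r))"
    and T: "\<And>n. n < length ys \<Longrightarrow> T (foldl g a (take n ys)) (ys ! n) \<le> B"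
  shows "s 0 = Node (Node c (Node a (tree_of ys))) r \<Longrightarrow>
    \<exists>t \<le> length ys * (B + 60) + 10.
      exec (While (Right (Right inp)) (Seq (Assign 0 pre) (Seq com (Assign 0 post)))) s t
        (s(0 := Node (Node c (Node (foldl g a ys) Leaf)) r))"
  using T
proof (induction ys arbitrary: a s)
  case Nil
  have "exec (While (Right (Right inp)) (Seq (Assign 0 pre) (Seq com (Assign 0 post)))) s
      (expr_cost (Right (Right inp)) + 1) s"
    by (rule exec_While_false) (simp add: Nil inp_def)
  moreover have "s(0 := Node (Node c (Node (foldl g a []) Leaf)) r) = s"
    using Nil by auto
  ultimately show ?case
    by (intro exI[of _ "expr_cost (Right (Right inp)) + 1"]) (simp add: inp_def)
next
  case (Cons y ys)
  let ?rest = "Node (Node c (tree_of ys)) r"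
  have 1: "exec (Assign 0 pre) s (expr_cost pre + 1) (s(0 := Node (Node (Node c a) y) ?rest))"
    by (rule exec_Assign_eq) (simp add: Cons.prems pre_def inp_def)
  from body[of "s(0 := Node (Node (Node c a) y) ?rest)" a y ?rest] obtain t where
    2: "t \<le> T a y" "exec com (s(0 := Node (Node (Node c a) y) ?rest)) t (s(0 := Node (g a y) ?rest))"
    by auto
  have 3: "exec (Assign 0 post) (s(0 := Node (g a y) ?rest)) (expr_cost post + 1)
      (s(0 := Node (Node c (Node (g a y) (tree_of ys))) r))"
    by (rule exec_Assign_eq) (simp add: post_def)
  have "T (foldl g (g a y) (take n ys)) (ys ! n) \<le> B" if "n < length ys" for n
    using Cons.prems(2)[of "Suc n"] that by simp
  from Cons.IH[of "s(0 := Node (Node c (Node (g a y) (tree_of ys))) r)" "g a y",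
      unfolded fun_upd_upd fun_upd_same, OF refl this]
  obtain u where 4: "u \<le> length ys * (B + 60) + 10"
    "exec (While (Right (Right inp)) (Seq (Assign 0 pre) (Seq com (Assign 0 post))))
      (s(0 := Node (Node c (Node (g a y) (tree_of ys))) r)) u
      (s(0 := Node (Node c (Node (foldl g (g a y) ys) Leaf)) r))"
    by blast
  have "expr_value (Right (Right inp)) s \<noteq> Leaf"
    using Cons.prems by (simp add: inp_def)
  note 5 = exec_While_true[OF this exec_Seq[OF 1 exec_Seq[OF 2(2) 3]] 4(2)]
  have "t \<le> B"
    using 2(1) Cons.prems(2)[of 0] by simp
  with 4(1) have "expr_cost (Right (Right inp)) + 1 + (expr_cost pre + 1 + (t + (expr_cost post + 1))) + u
      \<le> length (y # ys) * (B + 60) + 10"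
    by (simp add: pre_def post_def inp_def)
  with 5 show ?case
    unfolding foldl_Cons by blast
qed

lemma foldl_size_additive:
  fixes g :: "dtree \<Rightarrow> 'a \<Rightarrow> dtree"
  assumes "\<And>a y. y \<in> set ys \<Longrightarrow> size (g a y) \<le> size a + b"
  shows "size (foldl g a ys) \<le> size a + length ys * b"
  using assms
proof (induction ys arbitrary: a)
  case (Cons y ys)
  have "size (foldl g (g a y) ys) \<le> size (g a y) + length ys * b"
    using Cons by auto
  also have "\<dots> \<le> size a + length (y # ys) * b"
    using Cons.prems[of y a] by simp
  finally show ?case by simp
qed simp

text \<open>The essential condition is that \<open>h\<close> sees the context and the entry but not
  the accumulator. Growth is then additive over the rounds, all accumulators are of polynomial size,
  and so each round takes polynomial time.\<close>

lemma ptime_foldl: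
  assumes g: "ptime (\<lambda>z. g (left_child (left_child z)) (right_child (left_child z)) (right_child z))"
    and a: "ptime a" and xs: "ptime (\<lambda>x. tree_of (xs x))"
    and h: "poly_bounded h" "\<And>c a y. size (g c a y) \<le> size a + h (Node c y)"
  shows "ptime (\<lambda>x. foldl (g x) (a x) (xs x))"
proof -
  let ?G = "\<lambda>z. g (left_child (left_child z)) (right_child (left_child z)) (right_child z)"
  obtain c T where T: "poly_bounded T" and "computes c ?G T"
    using g unfolding ptime_def by blast
  note c = computesD[OF this(2)]
  obtain p q :: "nat poly" where p: "\<And>x. T x \<le> poly p (size x)" and q: "\<And>x. h x \<le> poly q (size x)"
    using T h(1) unfolding poly_bounded_def by blast
  have "ptime (\<lambda>x. Node x (Node (a x) (tree_of (xs x))))"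
    by (intro ptime_Node ptime_id a xs)
  then obtain d U where U: "poly_bounded U" and "computes d (\<lambda>x. Node x (Node (a x) (tree_of (xs x)))) U"
    unfolding ptime_def by blast
  note d = computesD[OF this(2)]
  \<comment> \<open>\<open>sz\<close> bounds both the number of entries and the size of each.
    \<open>M\<close> bounds every accumulator and \<open>B\<close> the time of one round; the
    summands 1 and 2 count the \<open>Node\<close>s that pack the arguments of \<open>h\<close> and
    of the step.\<close>
  define sz where "sz x = size (tree_of (xs x))" for x
  define M where "M x = size (a x) + sz x * poly q (size x + sz x + 1)" for x
  define B where "B x = poly p (size x + M x + sz x + 2)" for x
  have sz: "poly_bounded sz"
    unfolding sz_def using xs by (rule ptime_size)
  have M: "poly_bounded M"
    unfolding M_def by (intro poly_bounded_intros poly_bounded_poly sz ptime_size a)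
  have B: "poly_bounded B"
    unfolding B_def by (intro poly_bounded_intros poly_bounded_poly sz M)
  have size_elem: "size y \<le> sz x" if "y \<in> set (xs x)" for x y
    using size_spine[of y "tree_of (xs x)"] that by (simp add: sz_def)
  have len: "length (xs x) \<le> sz x" for x
    using length_spine[of "tree_of (xs x)"] by (simp add: sz_def)
  have acc: "size (foldl (g x) (a x) (take n (xs x))) \<le> M x" for x n
  proof -
    have "size (g x b y) \<le> size b + poly q (size x + sz x + 1)" if "y \<in> set (take n (xs x))" for b y
    proof -
      have "size y \<le> sz x"
        using that by (intro size_elem) (rule in_set_takeD)
      then have "poly q (size (Node x y)) \<le> poly q (size x + sz x + 1)"
        by (intro poly_nat_mono) simp
      then show ?thesis
        using h(2)[of x b y] q[of "Node x y"] by linarith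
    qed
    from foldl_size_additive[OF this]
    have "size (foldl (g x) (a x) (take n (xs x)))
        \<le> size (a x) + length (take n (xs x)) * poly q (size x + sz x + 1)" .
    also have "\<dots> \<le> M x"
      unfolding M_def using len[of x] by (intro add_left_mono mult_right_mono) auto
    finally show ?thesis .
  qed
  have time: "T (Node (Node x (foldl (g x) (a x) (take n (xs x)))) (xs x ! n)) \<le> B x"
    if "n < length (xs x)" for x n
  proof -
    have "size (xs x ! n) \<le> sz x"
      using that by (intro size_elem) simp
    then have "poly p (size (Node (Node x (foldl (g x) (a x) (take n (xs x)))) (xs x ! n))) \<le> B x"
      unfolding B_def using acc[of x n] by (intro poly_nat_mono) simp
    with p show ?thesis by (rule order_trans)
  qed
  let ?inp = "Left (Var 0)"
  let ?pre = "Mk_Node (Mk_Node (Mk_Node (Left ?inp) (Left (Right ?inp))) (Left (Right (Right ?inp))))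
    (Mk_Node (Mk_Node (Left ?inp) (Right (Right (Right ?inp)))) (Right (Var 0)))"
  let ?post = "Mk_Node (Mk_Node (Left (Left (Right (Var 0))))
    (Mk_Node (Left (Var 0)) (Right (Left (Right (Var 0)))))) (Right (Right (Var 0)))"
  let ?loop = "While (Right (Right ?inp)) (Seq (Assign 0 ?pre) (Seq c (Assign 0 ?post)))"
  let ?fin = "Mk_Node (Left (Right ?inp)) (Right (Var 0))"
  show ?thesis
  proof (rule ptimeI)
    show "poly_bounded (\<lambda>x. size (foldl (g x) (a x) (xs x)))"
    proof (rule poly_bounded_le[OF M])
      show "size (foldl (g x) (a x) (xs x)) \<le> M x" for x
        using acc[of x "length (xs x)"] by simp
    qed
    show "poly_bounded (\<lambda>x. U x + (sz x * (B x + 60) + 20))"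
      by (intro poly_bounded_intros U sz B)
    fix x r :: dtree and s :: "nat \<Rightarrow> dtree"
    assume s: "s 0 = Node x r"
    from d[of s x r, OF s] obtain t where 1: "t \<le> U x"
      "exec d s t (s(0 := Node (Node x (Node (a x) (tree_of (xs x)))) r))" by blast
    have "\<exists>u \<le> length (xs x) * (B x + 60) + 10. exec ?loop
        (s(0 := Node (Node x (Node (a x) (tree_of (xs x)))) r)) u
        ((s(0 := Node (Node x (Node (a x) (tree_of (xs x)))) r))
          (0 := Node (Node x (Node (foldl (g x) (a x) (xs x)) Leaf)) r))"
    proof (rule exec_fold_loop[where T = "\<lambda>b y. T (Node (Node x b) y)"])
      show "\<exists>t \<le> T (Node (Node x b) y). exec c s t (s(0 := Node (g x b y) r))"
        if "s 0 = Node (Node (Node x b) y) r" for b y r s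
        using c[of s "Node (Node x b) y" r, OF that] by simp
    qed (use time in auto)
    then obtain u where 2: "u \<le> length (xs x) * (B x + 60) + 10"
      "exec ?loop (s(0 := Node (Node x (Node (a x) (tree_of (xs x)))) r)) u
        (s(0 := Node (Node x (Node (foldl (g x) (a x) (xs x)) Leaf)) r))"
      by auto
    have 3: "exec (Assign 0 ?fin) (s(0 := Node (Node x (Node (foldl (g x) (a x) (xs x)) Leaf)) r))
        (expr_cost ?fin + 1) (s(0 := Node (foldl (g x) (a x) (xs x)) r))"
      by (rule exec_Assign_eq) simp
    have "length (xs x) * (B x + 60) \<le> sz x * (B x + 60)"
      using len[of x] by (intro mult_right_mono) auto
    moreover have "expr_cost ?fin + 1 = 8"
      by simp
    ultimately have "t + (u + (expr_cost ?fin + 1)) \<le> U x + (sz x * (B x + 60) + 20)"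
      using 1(1) 2(1) by linarith
    then show "\<exists>t \<le> U x + (sz x * (B x + 60) + 20).
        exec (Seq d (Seq ?loop (Assign 0 ?fin))) s t (s(0 := Node (foldl (g x) (a x) (xs x)) r))"
      using exec_Seq[OF 1(2) exec_Seq[OF 2(2) 3]] by blast
  qed
qed

text \<open>\<open>runs\<close> starts with the bare input in variable 0. One assignment turns it
  into a stack with a single entry and another unpacks the result.\<close>

lemma ptime_program:
  assumes "ptime f"
  shows "\<exists>c (p :: nat poly). \<forall>x. \<exists>t \<le> poly p (size x). runs c x t (f x)"
proof -
  obtain c T where T: "poly_bounded T" and "computes c f T"
    using assms unfolding ptime_def by blast
  note c = computesD[OF this(2)]
  have "poly_bounded (\<lambda>x. T x + 10)"
    by (intro poly_bounded_intros T)
  then obtain p :: "nat poly" where p: "\<And>x. T x + 10 \<le> poly p (size x)"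
    unfolding poly_bounded_def by blast
  let ?push = "Mk_Node (Var 0) Const_Leaf"
  have "\<exists>t \<le> poly p (size x). runs (Seq (Assign 0 ?push) (Seq c (Assign 0 (Left (Var 0))))) x t (f x)"
    for x
  proof -
    let ?s = "(\<lambda>_. Leaf)(0 := x)"
    have 1: "exec (Assign 0 ?push) ?s (expr_cost ?push + 1) (?s(0 := Node x Leaf))"
      by (rule exec_Assign_eq) simp
    from c[of "?s(0 := Node x Leaf)" x Leaf] obtain t where
      2: "t \<le> T x" "exec c (?s(0 := Node x Leaf)) t (?s(0 := Node (f x) Leaf))" by auto
    have 3: "exec (Assign 0 (Left (Var 0))) (?s(0 := Node (f x) Leaf)) (expr_cost (Left (Var 0)) + 1)
        (?s(0 := f x))"
      by (rule exec_Assign_eq) simp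
    have "expr_cost ?push + 1 + (t + (expr_cost (Left (Var 0)) + 1)) \<le> poly p (size x)"
      using 2(1) p[of x] by simp
    moreover have "(?s(0 := f x)) 0 = f x"
      by simp
    ultimately show ?thesis
      using exec_Seq[OF 1 exec_Seq[OF 2(2) 3]] unfolding runs_def by blast
  qed
  then show ?thesis by blast
qed

section \<open>Polynomial-time operations on lists\<close>

lemma ptime_spine: "ptime f \<Longrightarrow> ptime (\<lambda>x. tree_of (spine (f x)))"
  by simp

lemma ptime_Nil: "ptime (\<lambda>x. tree_of [])"
  by (simp add: ptime_const)

lemma ptime_Cons:
  "ptime f \<Longrightarrow> ptime (\<lambda>x. tree_of (g x)) \<Longrightarrow> ptime (\<lambda>x. tree_of (f x # g x))"
  by (simp add: ptime_Node)

lemma ptime_if_list: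
  assumes "ptime (\<lambda>x. truth (P x))" "ptime (\<lambda>x. tree_of (f x))" "ptime (\<lambda>x. tree_of (g x))"
  shows "ptime (\<lambda>x. tree_of (if P x then f x else g x))"
  using ptime_if[OF assms] by (simp add: if_distrib)

lemma ptime_not:
  assumes "ptime (\<lambda>x. truth (P x))"
  shows "ptime (\<lambda>x. truth (\<not> P x))"
proof -
  have "(\<lambda>x. truth (\<not> P x)) = (\<lambda>x. if P x then Leaf else Node Leaf Leaf)"
    by (auto simp: truth_def)
  then show ?thesis
    using ptime_if[OF assms ptime_const ptime_const] by simp
qed

lemma ptime_conj:
  assumes "ptime (\<lambda>x. truth (P x))" "ptime (\<lambda>x. truth (Q x))"
  shows "ptime (\<lambda>x. truth (P x \<and> Q x))"
proof -
  have "(\<lambda>x. truth (P x \<and> Q x)) = (\<lambda>x. if P x then truth (Q x) else Leaf)"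
    by (auto simp: truth_def)
  then show ?thesis
    using ptime_if[OF assms ptime_const] by simp
qed

lemma ptime_imp:
  assumes "ptime (\<lambda>x. truth (P x))" "ptime (\<lambda>x. truth (Q x))"
  shows "ptime (\<lambda>x. truth (P x \<longrightarrow> Q x))"
  using ptime_not[OF ptime_conj[OF assms(1) ptime_not[OF assms(2)]]] by simp

text \<open>This normalises an arbitrary tree to a value of \<open>truth\<close>. The program is
  given by hand because \<open>ptime_if\<close> expects its test in that form already.\<close>

lemma ptime_not_Leaf:
  assumes "ptime f"
  shows "ptime (\<lambda>x. truth (f x \<noteq> Leaf))"
proof (rule ptime_comp[OF _ assms, of "\<lambda>y. truth (y \<noteq> Leaf)"], rule ptimeI)
  show "poly_bounded (\<lambda>x. size (truth (x \<noteq> Leaf)))"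
    by (rule poly_bounded_le[OF poly_bounded_const[of 1]]) (simp add: truth_def)
  show "poly_bounded (\<lambda>_. 20)"
    by (rule poly_bounded_const)
  fix x r :: dtree and s :: "nat \<Rightarrow> dtree"
  assume s: "s 0 = Node x r"
  let ?t = "\<lambda>b. Mk_Node b (Right (Var 0))"
  let ?true = "?t (Mk_Node Const_Leaf Const_Leaf)" and ?false = "?t Const_Leaf"
  have "exec (Assign 0 ?true) s (expr_cost ?true + 1) (s(0 := Node (Node Leaf Leaf) r))"
    "exec (Assign 0 ?false) s (expr_cost ?false + 1) (s(0 := Node Leaf r))"
    by (rule exec_Assign_eq, simp add: s)+
  then obtain t where t: "t = expr_cost (Left (Var 0)) + 1 +
        (if x = Leaf then expr_cost ?false + 1 else expr_cost ?true + 1)"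
    and e: "exec (If (Left (Var 0)) (Assign 0 ?true) (Assign 0 ?false)) s t (s(0 := Node (truth (x \<noteq> Leaf)) r))"
    using s exec_If_true[of "Left (Var 0)" s] exec_If_false[of "Left (Var 0)" s]
    by (cases "x = Leaf") (simp_all add: truth_def)
  have "t \<le> 20"
    using t by simp
  with e show "\<exists>t \<le> 20. exec (If (Left (Var 0)) (Assign 0 ?true) (Assign 0 ?false)) s t
      (s(0 := Node (truth (x \<noteq> Leaf)) r))"
    by blast
qed

lemma ptime_eq_Leaf: "ptime f \<Longrightarrow> ptime (\<lambda>x. truth (f x = Leaf))"
  using ptime_not[OF ptime_not_Leaf] by simp

lemma ptime_eq_Nil: "ptime (\<lambda>x. tree_of (f x)) \<Longrightarrow> ptime (\<lambda>x. truth (f x = []))"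
  using ptime_eq_Leaf[of "\<lambda>x. tree_of (f x)"] by simp

lemmas ptime_basic = ptime_id ptime_const ptime_left ptime_right ptime_Node ptime_if
  ptime_spine ptime_Nil ptime_Cons ptime_if_list ptime_not ptime_conj ptime_imp
  ptime_eq_Leaf ptime_eq_Nil

text \<open>Consing in a left fold reverses, which makes this the primitive operation; reversal and
  concatenation are derived from it.\<close>

lemma ptime_rev_append:
  assumes "ptime (\<lambda>x. tree_of (f x))" "ptime (\<lambda>x. tree_of (g x))"
  shows "ptime (\<lambda>x. tree_of (rev (f x) @ g x))"
proof -
  have "tree_of (rev xs @ ys) = foldl (\<lambda>a y. Node y a) (tree_of ys) xs" for xs ys
  proof (induction xs arbitrary: ys)
    case (Cons x xs)
    then show ?case using Cons.IH[of "x # ys"] by simp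
  qed simp
  moreover have "ptime (\<lambda>x. foldl (\<lambda>a y. Node y a) (tree_of (g x)) (f x))"
    by (rule ptime_foldl[where g = "\<lambda>x a y. Node y a" and h = "\<lambda>z. size z + 1"])
      (intro ptime_basic assms poly_bounded_intros | simp)+
  ultimately show ?thesis by simp
qed

lemma ptime_rev:
  assumes "ptime (\<lambda>x. tree_of (f x))"
  shows "ptime (\<lambda>x. tree_of (rev (f x)))"
  using ptime_rev_append[OF assms ptime_Nil] by simp

lemma ptime_append:
  assumes "ptime (\<lambda>x. tree_of (f x))" "ptime (\<lambda>x. tree_of (g x))"
  shows "ptime (\<lambda>x. tree_of (f x @ g x))"
  using ptime_rev_append[OF ptime_rev[OF assms(1)] assms(2)] by simp

lemma size_tree_of_append: "size (tree_of (xs @ ys)) = size (tree_of xs) + size (tree_of ys)"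
  by (induction xs) auto

lemma size_tree_of_rev: "size (tree_of (rev xs)) = size (tree_of xs)"
  by (induction xs) (auto simp: size_tree_of_append)

text \<open>The result is accumulated in reverse and reversed once at the end. Each round adds the
  size of \<open>g x y\<close>, which does not involve the accumulator. Maps, filters and bounded
  quantifiers are special cases.\<close>

lemma ptime_concat_map:
  assumes f: "ptime (\<lambda>x. tree_of (f x))"
    and g: "ptime (\<lambda>z. tree_of (g (left_child z) (right_child z)))"
  shows "ptime (\<lambda>x. tree_of (concat (map (g x) (f x))))"
proof -
  have eq: "tree_of (rev (concat (map h xs)) @ ys)
      = foldl (\<lambda>a y. tree_of (rev (h y) @ spine a)) (tree_of ys) xs" for h ys and xs :: "dtree list"
    by (induction xs arbitrary: ys) simp_all
  have "ptime (\<lambda>x. foldl (\<lambda>a y. tree_of (rev (g x y) @ spine a)) Leaf (f x))"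
  proof (rule ptime_foldl[where g = "\<lambda>x a y. tree_of (rev (g x y) @ spine a)"])
    have "ptime (\<lambda>z. tree_of (g (left_child (left_child z)) (right_child z)))"
      using ptime_comp[OF g, of "\<lambda>z. Node (left_child (left_child z)) (right_child z)"]
      by (simp add: ptime_basic)
    then show "ptime (\<lambda>z. tree_of (rev (g (left_child (left_child z)) (right_child z))
        @ spine (right_child (left_child z))))"
      by (intro ptime_rev_append ptime_basic)
    show "poly_bounded (\<lambda>z. size (tree_of (g (left_child z) (right_child z))))"
      using g by (rule ptime_size)
  qed (auto simp: size_tree_of_append size_tree_of_rev intro: f ptime_basic)
  then have "ptime (\<lambda>x. tree_of (rev (concat (map (g x) (f x)))))"
    using eq[of _ _ "[]"] by simp
  from ptime_rev[OF this] show ?thesis by simp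
qed

lemma ptime_map:
  assumes "ptime (\<lambda>x. tree_of (f x))" "ptime (\<lambda>z. g (left_child z) (right_child z))"
  shows "ptime (\<lambda>x. tree_of (map (g x) (f x)))"
proof -
  have "map (g x) (f x) = concat (map (\<lambda>y. [g x y]) (f x))" for x by simp
  then show ?thesis
    using ptime_concat_map[OF assms(1), of "\<lambda>x y. [g x y]"] assms(2) by (simp add: ptime_basic)
qed

lemma ptime_filter:
  assumes "ptime (\<lambda>x. tree_of (f x))" "ptime (\<lambda>z. truth (P (left_child z) (right_child z)))"
  shows "ptime (\<lambda>x. tree_of (filter (P x) (f x)))"
proof -
  have "filter Q xs = concat (map (\<lambda>y. if Q y then [y] else []) xs)" for Q and xs :: "dtree list"
    by (induction xs) auto
  then show ?thesis
    using ptime_concat_map[OF assms(1), of "\<lambda>x y. if P x y then [y] else []"] assms(2)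
    by (simp add: ptime_basic del: enc_list.simps)
qed

lemma ptime_Ball:
  assumes "ptime (\<lambda>x. tree_of (f x))" "ptime (\<lambda>z. truth (P (left_child z) (right_child z)))"
  shows "ptime (\<lambda>x. truth (\<forall>y\<in>set (f x). P x y))"
proof -
  have "(\<forall>y\<in>set (f x). P x y) \<longleftrightarrow> filter (\<lambda>y. \<not> P x y) (f x) = []" for x
    by (auto simp: filter_empty_conv)
  then show ?thesis
    using ptime_eq_Nil[OF ptime_filter[OF assms(1) ptime_not[OF assms(2)]]] by simp
qed

lemma ptime_Bex:
  assumes "ptime (\<lambda>x. tree_of (f x))" "ptime (\<lambda>z. truth (P (left_child z) (right_child z)))"
  shows "ptime (\<lambda>x. truth (\<exists>y\<in>set (f x). P x y))"
  using ptime_not[OF ptime_Ball[OF assms(1) ptime_not[OF assms(2)]]] by simp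

text \<open>Lengths are compared without counters: each entry of \<open>f x\<close> deletes one
  entry of \<open>g x\<close>, and \<open>right_child Leaf = Leaf\<close> absorbs surplus
  deletions.\<close>

lemma ptime_drop_length:
  assumes f: "ptime (\<lambda>x. tree_of (f x))" and g: "ptime g"
  shows "ptime (\<lambda>x. foldl (\<lambda>a y. right_child a) (g x) (f x))"
proof (rule ptime_foldl[where g = "\<lambda>x a y. right_child a" and h = "\<lambda>z. 0"])
  show "size (right_child a) \<le> size a + 0" for a
    using size_right_child by simp
qed (intro ptime_basic poly_bounded_intros f g)+

lemma foldl_right_child_eq_Leaf:
  "foldl (\<lambda>a y. right_child a) (tree_of ys) xs = Leaf \<longleftrightarrow> length ys \<le> length xs"
proof (induction xs arbitrary: ys)
  case (Cons x xs)
  then show ?case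
    by (cases ys) (use Cons.IH[of "[]"] in auto)
qed simp

lemma ptime_length_le:
  assumes "ptime (\<lambda>x. tree_of (f x))" "ptime (\<lambda>x. tree_of (g x))"
  shows "ptime (\<lambda>x. truth (length (g x) \<le> length (f x)))"
  using ptime_eq_Leaf[OF ptime_drop_length[OF assms]] by (simp add: foldl_right_child_eq_Leaf)

definition zip_trees :: "dtree list \<Rightarrow> dtree list \<Rightarrow> dtree list" where
  "zip_trees xs ys = map (\<lambda>(x, y). Node x y) (zip xs ys)"

text \<open>The fold runs over the first list. The second list travels inside the accumulator and
  loses an entry per round, next to the pairs collected in reverse.\<close>

lemma ptime_zip_trees:
  assumes "ptime (\<lambda>x. tree_of (f x))" "ptime (\<lambda>x. tree_of (g x))"
  shows "ptime (\<lambda>x. tree_of (zip_trees (f x) (g x)))"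
proof -
  define step where "step a x = (if right_child a = Leaf then a
    else Node (Node (Node x (left_child (right_child a))) (left_child a)) (right_child (right_child a)))"
    for a x
  \<comment> \<open>When the second list is exhausted the accumulator is frozen, just as
    \<open>zip\<close> stops.\<close>
  have skip: "foldl step (Node a Leaf) xs = Node a Leaf" for a xs
    by (induction xs) (auto simp: step_def)
  have eq: "left_child (foldl step (Node (tree_of zs) (tree_of ys)) xs)
      = tree_of (rev (zip_trees xs ys) @ zs)" for xs ys zs
  proof (induction xs arbitrary: ys zs)
    case Nil
    then show ?case by (simp add: zip_trees_def)
  next
    case (Cons x xs)
    show ?case
    proof (cases ys)
      case Nil
      have "step (Node (tree_of zs) Leaf) x = Node (tree_of zs) Leaf"
        by (simp add: step_def)
      with Nil show ?thesis by (simp add: zip_trees_def skip)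
    next
      case (Cons y ys')
      then show ?thesis
        using Cons.IH[of "Node x y # zs" ys'] by (simp add: zip_trees_def step_def)
    qed
  qed
  have "ptime (\<lambda>x. foldl step (Node Leaf (tree_of (g x))) (f x))"
  proof (rule ptime_foldl[where g = "\<lambda>x. step" and h = "\<lambda>z. size z + 2"])
    show "size (step a y) \<le> size a + (size (Node c y) + 2)" for a c y
      by (cases a; cases "right_child a") (auto simp: step_def)
    show "ptime (\<lambda>z. step (right_child (left_child z)) (right_child z))"
      unfolding step_def by (intro ptime_basic)
  qed (intro ptime_basic poly_bounded_intros assms)+
  then have "ptime (\<lambda>x. tree_of (rev (zip_trees (f x) (g x))))"
    using ptime_left eq[where zs = "[]"] by fastforce
  from ptime_rev[OF this] show ?thesis by simp
qed

lemmas ptime_intros = ptime_basic ptime_append ptime_concat_map ptime_map ptime_filter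
  ptime_Ball ptime_Bex ptime_length_le ptime_zip_trees

text \<open>The machine cannot compare trees. A binary digit is \<open>Leaf\<close> or a nonempty
  tree, so for numerals it suffices to compare the lengths and, position by position, which digits
  are \<open>Leaf\<close>.\<close>

definition same_nat :: "dtree \<Rightarrow> dtree \<Rightarrow> bool" where
  "same_nat x y \<longleftrightarrow> length (spine x) \<le> length (spine y) \<and> length (spine y) \<le> length (spine x) \<and>
     (\<forall>z\<in>set (zip_trees (spine x) (spine y)).
        (left_child z = Leaf \<longrightarrow> right_child z = Leaf) \<and> (right_child z = Leaf \<longrightarrow> left_child z = Leaf))"

lemma ptime_same_nat:
  assumes "ptime f" "ptime g"
  shows "ptime (\<lambda>x. truth (same_nat (f x) (g x)))"
  unfolding same_nat_def by (intro ptime_intros assms)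

text \<open>Induction along the digits: a number is determined by its parity and its half, and a
  positive number never has the empty numeral.\<close>

lemma same_nat_enc_nat: "same_nat (enc_nat m) (enc_nat n) \<longleftrightarrow> m = n"
proof -
  have "same_nat x y \<longleftrightarrow> list_all2 (\<lambda>x y. x = Leaf \<longleftrightarrow> y = Leaf) (spine x) (spine y)" for x y
    by (auto simp: same_nat_def list_all2_iff zip_trees_def)
  moreover have "list_all2 (\<lambda>x y. x = Leaf \<longleftrightarrow> y = Leaf) (spine (enc_nat m)) (spine (enc_nat n))
      \<longleftrightarrow> m = n"
  proof (induction m arbitrary: n rule: less_induct)
    case (less m)
    show ?case
    proof (cases "m = 0 \<or> n = 0")
      case True
      then show ?thesis
        by (auto simp: enc_nat.simps[of 0] enc_nat.simps[of m] enc_nat.simps[of n])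
    next
      case False
      then have "list_all2 (\<lambda>x y. x = Leaf \<longleftrightarrow> y = Leaf) (spine (enc_nat m)) (spine (enc_nat n))
          \<longleftrightarrow> (odd m \<longleftrightarrow> odd n) \<and> m div 2 = n div 2"
        using less.IH[of "m div 2" "n div 2"]
        by (simp add: enc_nat.simps[of m] enc_nat.simps[of n])
      also have "\<dots> \<longleftrightarrow> m = n"
        by (metis odd_two_times_div_two_succ even_two_times_div_two)
      finally show ?thesis .
    qed
  qed
  ultimately show ?thesis by simp
qed

section \<open>The algorithm on lists\<close>

fun appends :: "nat \<Rightarrow> 'a list list \<Rightarrow> 'a list list" where
  "appends 0 xs = [[]]"
| "appends (Suc k) xs = concat (map (\<lambda>x. map ((@) x) (appends k xs)) xs)"

text \<open>Compatibility for association lists in which keys may repeat. \<open>agree f f\<close>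
  says that the entries of \<open>f\<close> form the graph of a function.\<close>

definition agree :: "('a \<times> 'b) list \<Rightarrow> ('a \<times> 'b) list \<Rightarrow> bool" where
  "agree f g \<longleftrightarrow> (\<forall>p\<in>set f. \<forall>q\<in>set g. fst p = fst q \<longrightarrow> snd p = snd q)"

type_synonym relations = "(nat \<times> nat list list \<times> nat list list) list"

definition edge_lists :: "relations \<Rightarrow> nat list list" where
  "edge_lists rs = concat (map (\<lambda>r. fst (snd r)) rs)"

definition tuple_pairs :: "relations \<Rightarrow> (nat \<times> nat) list list" where
  "tuple_pairs rs = concat (map (\<lambda>r. concat (map (\<lambda>t. map (zip t) (snd (snd r))) (fst (snd r)))) rs)"

definition projective :: "relations \<Rightarrow> (nat \<times> nat) list \<Rightarrow> bool" where
  "projective rs f \<longleftrightarrow> (\<forall>r\<in>set rs. \<forall>t\<in>set (fst (snd r)). \<exists>s\<in>set (snd (snd r)). agree f (zip t s))"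

definition initial_maps :: "nat \<Rightarrow> relations \<Rightarrow> (nat \<times> nat) list list" where
  "initial_maps k rs = filter (\<lambda>f. agree f f \<and> projective rs f) (appends k (tuple_pairs rs))"

text \<open>Membership is spelled out as a bounded quantifier over equations, to be translated to
  trees by \<open>same_nat\<close>.\<close>

definition covers :: "(nat \<times> nat) list \<Rightarrow> nat list \<Rightarrow> bool" where
  "covers g u \<longleftrightarrow> (\<forall>p\<in>set g. \<exists>v\<in>set u. fst p = v) \<and> (\<forall>v\<in>set u. \<exists>p\<in>set g. fst p = v)"

definition prune :: "nat list list \<Rightarrow> (nat \<times> nat) list list \<Rightarrow> (nat \<times> nat) list list" where
  "prune us L = filter (\<lambda>f. \<forall>u\<in>set us. \<exists>g\<in>set L. covers g u \<and> agree f g) L"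

text \<open>The candidates serve twice, as the start value and as a clock. A fold that ignores its
  entries replaces an unbounded loop and falls under \<open>ptime_foldl\<close>.\<close>

definition consistency :: "nat \<Rightarrow> relations \<Rightarrow> (nat \<times> nat) list list" where
  "consistency k rs =
     foldl (\<lambda>L _. prune (appends k (edge_lists rs)) L) (initial_maps k rs) (initial_maps k rs)"

section \<open>The algorithm on trees\<close>

fun appends_tree :: "nat \<Rightarrow> dtree list \<Rightarrow> dtree list" where
  "appends_tree 0 xs = [Leaf]"
| "appends_tree (Suc k) xs =
     concat (map (\<lambda>x. map (\<lambda>y. tree_of (spine x @ spine y)) (appends_tree k xs)) xs)"

definition agree_tree :: "dtree \<Rightarrow> dtree \<Rightarrow> bool" where
  "agree_tree f g \<longleftrightarrow> (\<forall>p\<in>set (spine f). \<forall>q\<in>set (spine g).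
     same_nat (left_child p) (left_child q) \<longrightarrow> same_nat (right_child p) (right_child q))"

text \<open>An encoded relation is a pair of the arity and a pair of tuple lists, so
  \<open>right_child r\<close> skips the arity.\<close>

definition edge_tree :: "dtree \<Rightarrow> dtree list" where
  "edge_tree rs = concat (map (\<lambda>r. spine (left_child (right_child r))) (spine rs))"

definition tuple_pairs_tree :: "dtree \<Rightarrow> dtree list" where
  "tuple_pairs_tree rs = concat (map (\<lambda>r. concat (map (\<lambda>t.
     map (\<lambda>s. tree_of (zip_trees (spine t) (spine s))) (spine (right_child (right_child r))))
     (spine (left_child (right_child r))))) (spine rs))"

definition projective_tree :: "dtree \<Rightarrow> dtree \<Rightarrow> bool" where
  "projective_tree rs f \<longleftrightarrow>
     (\<forall>r\<in>set (spine rs). \<forall>t\<in>set (spine (left_child (right_child r))).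
        \<exists>s\<in>set (spine (right_child (right_child r))). agree_tree f (tree_of (zip_trees (spine t) (spine s))))"

definition initial_tree :: "nat \<Rightarrow> dtree \<Rightarrow> dtree list" where
  "initial_tree k rs =
     filter (\<lambda>f. agree_tree f f \<and> projective_tree rs f) (appends_tree k (tuple_pairs_tree rs))"

definition covers_tree :: "dtree \<Rightarrow> dtree \<Rightarrow> bool" where
  "covers_tree g u \<longleftrightarrow>
     (\<forall>p\<in>set (spine g). \<exists>v\<in>set (spine u). same_nat (left_child p) v) \<and>
     (\<forall>v\<in>set (spine u). \<exists>p\<in>set (spine g). same_nat (left_child p) v)"

definition prune_tree :: "dtree list \<Rightarrow> dtree list \<Rightarrow> dtree list" where
  "prune_tree us L = filter (\<lambda>f. \<forall>u\<in>set us. \<exists>g\<in>set L. covers_tree g u \<and> agree_tree f g) L"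

definition consistency_tree :: "nat \<Rightarrow> dtree \<Rightarrow> dtree" where
  "consistency_tree k rs =
     foldl (\<lambda>L _. tree_of (prune_tree (appends_tree k (edge_tree rs)) (spine L)))
       (tree_of (initial_tree k rs)) (initial_tree k rs)"

section \<open>Running time of the tree version\<close>

lemma ptime_appends_tree:
  assumes "ptime (\<lambda>x. tree_of (f x))"
  shows "ptime (\<lambda>x. tree_of (appends_tree k (f x)))"
proof -
  have "ptime (\<lambda>z. tree_of (appends_tree k (spine z)))"
  \<comment> \<open>\<open>k\<close> is a constant of the program and not an input: every successor
    adds one nested loop, so the degree of the bound may grow with \<open>k\<close>.\<close>
  proof (induction k)
    case 0
    show ?case by (simp add: ptime_basic)
  next
    case (Suc k)
    have "ptime (\<lambda>z. tree_of (appends_tree k (spine (left_child z))))"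
      using ptime_comp[OF Suc ptime_left[OF ptime_id]] .
    then show ?case
      unfolding appends_tree.simps by (intro ptime_intros)
  qed
  from ptime_comp[OF this assms] show ?thesis by simp
qed

lemma ptime_agree_tree:
  assumes "ptime f" "ptime g"
  shows "ptime (\<lambda>x. truth (agree_tree (f x) (g x)))"
proof -
  have "ptime (\<lambda>z. truth (agree_tree (left_child z) (right_child z)))"
    unfolding agree_tree_def by (intro ptime_intros ptime_same_nat)
  from ptime_comp[OF this ptime_Node[OF assms]] show ?thesis by simp
qed

lemma ptime_covers_tree:
  assumes "ptime f" "ptime g"
  shows "ptime (\<lambda>x. truth (covers_tree (f x) (g x)))"
proof -
  have "ptime (\<lambda>z. truth (covers_tree (left_child z) (right_child z)))"
    unfolding covers_tree_def by (intro ptime_intros ptime_same_nat)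
  from ptime_comp[OF this ptime_Node[OF assms]] show ?thesis by simp
qed

lemma ptime_projective_tree:
  assumes "ptime f" "ptime g"
  shows "ptime (\<lambda>x. truth (projective_tree (f x) (g x)))"
proof -
  have "ptime (\<lambda>z. truth (projective_tree (left_child z) (right_child z)))"
    unfolding projective_tree_def by (intro ptime_intros ptime_agree_tree)
  from ptime_comp[OF this ptime_Node[OF assms]] show ?thesis by simp
qed

lemma ptime_edge_tree:
  assumes "ptime f"
  shows "ptime (\<lambda>x. tree_of (edge_tree (f x)))"
  unfolding edge_tree_def by (intro ptime_intros assms)

lemma ptime_tuple_pairs_tree: "ptime (\<lambda>x. tree_of (tuple_pairs_tree x))"
  unfolding tuple_pairs_tree_def by (intro ptime_intros)

lemma ptime_initial_tree: "ptime (\<lambda>x. tree_of (initial_tree k x))"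
  unfolding initial_tree_def
  by (intro ptime_intros ptime_appends_tree ptime_tuple_pairs_tree ptime_agree_tree
      ptime_projective_tree)

lemma size_tree_of_filter: "size (tree_of (filter P xs)) \<le> size (tree_of xs)"
  by (induction xs) auto

text \<open>Pruning is a filter, so the accumulator never grows and the additive bound is 0.\<close>

lemma ptime_consistency_tree: "ptime (consistency_tree k)"
  unfolding consistency_tree_def
proof (rule ptime_foldl[where h = "\<lambda>z. 0" and
      g = "\<lambda>x L _. tree_of (prune_tree (appends_tree k (edge_tree x)) (spine L))"])
  let ?c = "\<lambda>z. left_child (left_child z)"
  show "ptime (\<lambda>z. tree_of (prune_tree (appends_tree k (edge_tree (?c z)))
      (spine (right_child (left_child z)))))"
    unfolding prune_tree_def
    by (intro ptime_intros ptime_appends_tree ptime_edge_tree ptime_covers_tree ptime_agree_tree)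
  show "size (tree_of (prune_tree (appends_tree k (edge_tree c)) (spine a))) \<le> size a + 0" for c a
    using size_tree_of_filter[of _ "spine a"] by (simp add: prune_tree_def)
qed (intro ptime_initial_tree poly_bounded_intros)+

section \<open>The tree version on encodings\<close>

abbreviation enc_maps :: "(nat \<times> nat) list \<Rightarrow> dtree" where
  "enc_maps \<equiv> enc_list (enc_pair enc_nat enc_nat)"

abbreviation enc_relations :: "relations \<Rightarrow> dtree" where
  "enc_relations \<equiv> enc_list (enc_pair enc_nat
     (enc_pair (enc_list (enc_list enc_nat)) (enc_list (enc_list enc_nat))))"

lemma left_child_enc_pair [simp]: "left_child (enc_pair f g p) = f (fst p)"
  and right_child_enc_pair [simp]: "right_child (enc_pair f g p) = g (snd p)"
  by (cases p; simp)+

lemma appends_tree_enc: "appends_tree k (map (enc_list e) xs) = map (enc_list e) (appends k xs)"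
  by (induction k) (simp_all add: map_concat o_def tree_of_map flip: map_append)

lemma zip_trees_enc:
  "zip_trees (map e xs) (map e' ys) = map (enc_pair e e') (zip xs ys)"
  by (simp add: zip_trees_def zip_map_map case_prod_beta o_def)
    (auto simp: enc_pair.simps)

lemma agree_tree_enc [simp]: "agree_tree (enc_maps f) (enc_maps g) \<longleftrightarrow> agree f g"
  by (simp add: agree_tree_def agree_def same_nat_enc_nat)

lemma covers_tree_enc [simp]: "covers_tree (enc_maps g) (enc_list enc_nat u) \<longleftrightarrow> covers g u"
  by (simp add: covers_tree_def covers_def same_nat_enc_nat)

lemma projective_tree_enc [simp]:
  "projective_tree (enc_relations rs) (enc_maps f) \<longleftrightarrow> projective rs f"
  by (simp add: projective_tree_def projective_def zip_trees_enc tree_of_map)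

lemma edge_tree_enc: "edge_tree (enc_relations rs) = map (enc_list enc_nat) (edge_lists rs)"
  by (simp add: edge_tree_def edge_lists_def map_concat o_def)

lemma tuple_pairs_tree_enc: "tuple_pairs_tree (enc_relations rs) = map enc_maps (tuple_pairs rs)"
  by (simp add: tuple_pairs_tree_def tuple_pairs_def map_concat o_def zip_trees_enc tree_of_map)

lemma initial_tree_enc: "initial_tree k (enc_relations rs) = map enc_maps (initial_maps k rs)"
  by (simp add: initial_tree_def initial_maps_def tuple_pairs_tree_enc appends_tree_enc
      filter_map o_def)

lemma prune_tree_enc:
  "prune_tree (map (enc_list enc_nat) us) (map enc_maps L) = map enc_maps (prune us L)"
  by (simp add: prune_tree_def prune_def filter_map o_def)

lemma consistency_tree_enc:
  "consistency_tree k (enc_relations rs) = enc_list enc_maps (consistency k rs)"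
proof -
  \<comment> \<open>The two folds run over lists of different types. As these lists only count
    rounds, equal length is all that matters.\<close>
  have *: "foldl (\<lambda>L _. tree_of (prune_tree (map (enc_list enc_nat) us) (spine L)))
      (enc_list enc_maps L) (xs :: dtree list)
    = enc_list enc_maps (foldl (\<lambda>L _. prune us L) L (ys :: 'a list))"
    if "length xs = length ys" for us L xs ys
    using that
    by (induction xs ys arbitrary: L rule: list_induct2) (simp_all add: prune_tree_enc tree_of_map)
  show ?thesis
    unfolding consistency_tree_def consistency_def initial_tree_enc edge_tree_enc
      appends_tree_enc tree_of_map
    by (rule *) simp
qed

section \<open>The fixpoint computed by the algorithm\<close>

definition compatible :: "('a \<rightharpoonup> 'b) \<Rightarrow> ('a \<rightharpoonup> 'b) \<Rightarrow> bool" where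
  "compatible f g \<longleftrightarrow> (\<forall>x \<in> dom f \<inter> dom g. f x = g x)"

definition stable :: "nat \<Rightarrow> 's signature \<Rightarrow> ('s, 'a) rel_structure \<Rightarrow> ('a \<rightharpoonup> 'b) set \<Rightarrow> bool" where
  "stable k \<sigma> A M \<longleftrightarrow> (\<forall>f\<in>M. \<forall>U\<in>k_unions k \<sigma> A. \<exists>g\<in>M. dom g = U \<and> compatible f g)"

lemma stableD:
  assumes "stable k \<sigma> A M" "f \<in> M" "U \<in> k_unions k \<sigma> A"
  shows "\<exists>g\<in>M. dom g = U \<and> compatible f g"
  using assms unfolding stable_def by simp

definition union_maps ::
  "nat \<Rightarrow> 's signature \<Rightarrow> ('s, 'a) rel_structure \<Rightarrow> ('s, 'b) rel_structure \<Rightarrow> ('a \<rightharpoonup> 'b) set" where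
  "union_maps k \<sigma> A B = {h. dom h \<in> k_unions k \<sigma> A \<and> projective_hom \<sigma> A B h}"

lemma hyperedge_subset:
  assumes "finite_structure \<sigma> A" "e \<in> hyperedges \<sigma> A"
  shows "e \<subseteq> universe A"
  using assms unfolding hyperedges_def finite_structure_def by blast

lemma k_union_subset:
  assumes "finite_structure \<sigma> A" "U \<in> k_unions k \<sigma> A"
  shows "U \<subseteq> universe A"
  using assms(2) hyperedge_subset[OF assms(1)] unfolding k_unions_def by blast

lemma finite_k_union:
  assumes "finite_structure \<sigma> A" "U \<in> k_unions k \<sigma> A"
  shows "finite U"
  using k_union_subset[OF assms] assms(1) finite_subset unfolding finite_structure_def by blast

lemma listing:
  assumes "finite U"
  shows "distinct (listing U)" "set (listing U) = U"
proof -
  have "distinct (listing U) \<and> set (listing U) = U"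
    unfolding listing_def
    by (rule someI_ex) (use finite_distinct_list[OF assms] in blast)
  then show "distinct (listing U)" "set (listing U) = U" by simp_all
qed

lemma dom_tuple_map:
  assumes "finite U" "length bs = length (listing U)"
  shows "dom (tuple_map U bs) = U"
  using assms listing(2) unfolding tuple_map_def by simp

lemma ran_tuple_map:
  assumes "finite U" "length bs = length (listing U)"
  shows "ran (tuple_map U bs) = set bs"
  unfolding tuple_map_def by (rule ran_map_of_zip) (simp_all add: assms listing)

lemma tuple_map_nth:
  assumes "finite U" "length bs = length (listing U)" "i < length (listing U)"
  shows "tuple_map U bs (listing U ! i) = Some (bs ! i)"
  unfolding tuple_map_def using assms by (intro map_of_zip_nth) (simp_all add: listing)

lemma tuple_map_of_map:
  assumes "finite (dom h)"
  shows "tuple_map (dom h) (map (\<lambda>x. the (h x)) (listing (dom h))) = h"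
proof
  fix x
  show "tuple_map (dom h) (map (\<lambda>x. the (h x)) (listing (dom h))) x = h x"
    using listing(2)[OF assms]
    by (cases "h x") (auto simp: tuple_map_def map_of_zip_map)
qed

text \<open>In the derived left structure each symbol has the single tuple \<open>listing U\<close>.
  Being a projective homomorphism thus means having, for every k-union, a compatible tuple that is
  still present.\<close>

lemma projective_hom_union:
  assumes "finite_structure \<sigma> A" "dom f \<subseteq> universe A" "ran f \<subseteq> universe S"
    and len: "\<And>U bs. U \<in> k_unions k \<sigma> A \<Longrightarrow> bs \<in> rel S U \<Longrightarrow> length bs = length (listing U)"
  shows "projective_hom (union_signature k \<sigma> A) (union_left A) S f \<longleftrightarrow>
    (\<forall>U\<in>k_unions k \<sigma> A. \<exists>bs\<in>rel S U. compatible f (tuple_map U bs))"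
proof -
  have "(length bs = length (listing U) \<and>
        (\<forall>i<length (listing U). listing U ! i \<in> dom f \<longrightarrow> f (listing U ! i) = Some (bs ! i)))
      \<longleftrightarrow> compatible f (tuple_map U bs)" (is "?L \<longleftrightarrow> ?R")
    if U: "U \<in> k_unions k \<sigma> A" and bs: "bs \<in> rel S U" for U bs
  proof -
    note fin = finite_k_union[OF assms(1) U] and len = len[OF U bs]
    have "?R \<longleftrightarrow> (\<forall>x\<in>set (listing U). x \<in> dom f \<longrightarrow> f x = tuple_map U bs x)"
      using dom_tuple_map[OF fin len] listing(2)[OF fin] unfolding compatible_def by auto
    also have "\<dots> \<longleftrightarrow> ?L"
      unfolding all_set_conv_all_nth using tuple_map_nth[OF fin len] len by simp
    finally show ?thesis by simp
  qed
  then show ?thesis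
    using assms(2,3) unfolding projective_hom_def union_signature_def union_left_def by auto
qed

lemma pkc_final_rel:
  assumes "pkc_final k \<sigma> A B S"
  shows "universe S = universe B" "rel S U \<subseteq> rel (union_right \<sigma> A B) U"
  using assms removal_lower[of k \<sigma> A "union_right \<sigma> A B" S]
  unfolding pkc_final_def by (simp_all add: union_right_def)

lemma remaining_maps_subset:
  assumes "finite_structure \<sigma> A" "pkc_final k \<sigma> A B S"
  shows "remaining_maps k \<sigma> A S \<subseteq> union_maps k \<sigma> A B"
proof
  fix h assume "h \<in> remaining_maps k \<sigma> A S"
  then obtain U bs where h: "h = tuple_map U bs" and U: "U \<in> k_unions k \<sigma> A" and "bs \<in> rel S U"
    unfolding remaining_maps_def by blast
  then have "bs \<in> rel (union_right \<sigma> A B) U"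
    using pkc_final_rel(2)[OF assms(2)] by blast
  then have len: "length bs = length (listing U)" and "projective_hom \<sigma> A B (tuple_map U bs)"
    by (simp_all add: union_right_def)
  then show "h \<in> union_maps k \<sigma> A B"
    using U dom_tuple_map[OF finite_k_union[OF assms(1) U] len] unfolding h union_maps_def by simp
qed

lemma pkc_final_projective_hom:
  assumes "pkc_final k \<sigma> A B S" "U \<in> k_unions k \<sigma> A" "bs \<in> rel S U"
  shows "projective_hom (union_signature k \<sigma> A) (union_left A) S (tuple_map U bs)"
proof (rule ccontr)
  assume "\<not> projective_hom (union_signature k \<sigma> A) (union_left A) S (tuple_map U bs)"
  then have "removal k \<sigma> A S (S\<lparr>rel := (rel S)(U := rel S U - {bs})\<rparr>)"
    unfolding removal_def using assms(2,3) by blast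
  then show False
    using assms(1) unfolding pkc_final_def by blast
qed

lemma stable_remaining_maps:
  assumes A: "finite_structure \<sigma> A" and S: "pkc_final k \<sigma> A B S"
  shows "stable k \<sigma> A (remaining_maps k \<sigma> A S)"
  unfolding stable_def
proof (intro ballI)
  fix f U
  assume f: "f \<in> remaining_maps k \<sigma> A S" and U: "U \<in> k_unions k \<sigma> A"
  have len: "length bs = length (listing V)" if "bs \<in> rel S V" for V bs
    using pkc_final_rel(2)[OF S] that unfolding union_right_def by auto
  obtain V bs where "f = tuple_map V bs" "V \<in> k_unions k \<sigma> A" "bs \<in> rel S V"
    using f unfolding remaining_maps_def by blast
  then have "projective_hom (union_signature k \<sigma> A) (union_left A) S f"
    using pkc_final_projective_hom[OF S] by simp
  moreover have "f \<in> union_maps k \<sigma> A B"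
    using f remaining_maps_subset[OF A S] by blast
  then have "dom f \<subseteq> universe A" "ran f \<subseteq> universe S"
    unfolding union_maps_def projective_hom_def pkc_final_rel(1)[OF S] by simp_all
  ultimately obtain cs where cs: "cs \<in> rel S U" "compatible f (tuple_map U cs)"
    using projective_hom_union[OF A, of f S k] len U by blast
  then show "\<exists>g\<in>remaining_maps k \<sigma> A S. dom g = U \<and> compatible f g"
    using U dom_tuple_map[OF finite_k_union[OF A U] len[OF cs(1)]] unfolding remaining_maps_def
    by blast
qed

text \<open>The stable set is turned into a right structure \<open>T\<close> on which no removal
  applies. As \<open>T\<close> lies below the initial structure, \<open>removal_upper\<close> keeps
  it below the final one.\<close>

lemma stable_subset_remaining_maps:
  assumes A: "finite_structure \<sigma> A" and S: "pkc_final k \<sigma> A B S"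
    and M: "M \<subseteq> union_maps k \<sigma> A B" "stable k \<sigma> A M"
  shows "M \<subseteq> remaining_maps k \<sigma> A S"
proof
  fix f assume f: "f \<in> M"
  \<comment> \<open>The condition on \<open>U\<close> empties \<open>T\<close> away from the
    k-unions, since \<open>removal_upper\<close> compares the structures at every
    \<open>U\<close>.\<close>
  define T where "T = \<lparr>universe = universe B, rel = (\<lambda>U.
    {bs. U \<in> k_unions k \<sigma> A \<and> length bs = length (listing U) \<and> tuple_map U bs \<in> M})\<rparr>"
  have M_hom: "projective_hom \<sigma> A B g" if "g \<in> M" for g
    using M(1) that unfolding union_maps_def by blast
  have mem: "map (\<lambda>x. the (g x)) (listing (dom g)) \<in> rel T (dom g)"
    "tuple_map (dom g) (map (\<lambda>x. the (g x)) (listing (dom g))) = g"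
    if "g \<in> M" for g
  proof -
    have "dom g \<in> k_unions k \<sigma> A"
      using M(1) that unfolding union_maps_def by blast
    then show "tuple_map (dom g) (map (\<lambda>x. the (g x)) (listing (dom g))) = g"
      using finite_k_union[OF A] by (intro tuple_map_of_map)
    then show "map (\<lambda>x. the (g x)) (listing (dom g)) \<in> rel T (dom g)"
      using that \<open>dom g \<in> k_unions k \<sigma> A\<close> by (simp add: T_def)
  qed
  have stuck: "\<not> (\<exists>T'. removal k \<sigma> A T T')"
  proof
    assume "\<exists>T'. removal k \<sigma> A T T'"
    then obtain U bs where U: "U \<in> k_unions k \<sigma> A" and bs: "bs \<in> rel T U"
      and not: "\<not> projective_hom (union_signature k \<sigma> A) (union_left A) T (tuple_map U bs)"
      unfolding removal_def by blast
    let ?g = "tuple_map U bs"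
    have g: "?g \<in> M" using bs by (simp add: T_def)
    have "\<exists>cs\<in>rel T V. compatible ?g (tuple_map V cs)" if V: "V \<in> k_unions k \<sigma> A" for V
    proof -
      obtain g' where "g' \<in> M" "dom g' = V" "compatible ?g g'"
        using stableD[OF M(2) g V] by blast
      then show ?thesis
        using mem[of g'] by (intro bexI[of _ "map (\<lambda>x. the (g' x)) (listing V)"]) auto
    qed
    moreover have "dom ?g \<subseteq> universe A" "ran ?g \<subseteq> universe T"
      using M_hom[OF g] unfolding projective_hom_def T_def by simp_all
    ultimately have "projective_hom (union_signature k \<sigma> A) (union_left A) T ?g"
      using projective_hom_union[OF A, of ?g T k] by (simp add: T_def)
    with not show False ..
  qed
  have upper: "rel T U \<subseteq> rel (union_right \<sigma> A B) U" for U
  proof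
    fix bs assume bs: "bs \<in> rel T U"
    then have U: "U \<in> k_unions k \<sigma> A" and len: "length bs = length (listing U)"
      and hom: "projective_hom \<sigma> A B (tuple_map U bs)"
      using M_hom by (simp_all add: T_def)
    have "set bs \<subseteq> universe B"
      using hom ran_tuple_map[OF finite_k_union[OF A U] len] unfolding projective_hom_def by simp
    with len hom show "bs \<in> rel (union_right \<sigma> A B) U"
      unfolding union_right_def by simp
  qed
  have "universe T = universe (union_right \<sigma> A B)"
    by (simp add: T_def union_right_def)
  then have sub: "rel T U \<subseteq> rel S U" for U
    using removal_upper[OF _ stuck _ upper, of S] S unfolding pkc_final_def by simp
  have "dom f \<in> k_unions k \<sigma> A"
    using M(1) f unfolding union_maps_def by blast
  then have "tuple_map (dom f) (map (\<lambda>x. the (f x)) (listing (dom f))) \<in> remaining_maps k \<sigma> A S"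
    using subsetD[OF sub mem(1)[OF f]] unfolding remaining_maps_def by blast
  then show "f \<in> remaining_maps k \<sigma> A S"
    by (simp add: mem(2)[OF f])
qed

text \<open>Uniqueness of the final structure allows any given \<open>S\<close> to replace the
  existentially quantified one.\<close>

lemma reports_inconsistency_iff:
  assumes "csp_instance \<sigma> A B" "pkc_final k \<sigma> A B S"
  shows "reports_inconsistency k \<sigma> A B \<longleftrightarrow> remaining_maps k \<sigma> A S = {}"
proof -
  have "reports_inconsistency k \<sigma> A B \<longleftrightarrow> (\<forall>U\<in>k_unions k \<sigma> A. rel S U = {})"
    using ex1_pkc_final[OF assms(1)] assms(2) unfolding reports_inconsistency_def by blast
  then show ?thesis
    unfolding remaining_maps_def by auto
qed

section \<open>Gluing along a tree decomposition\<close>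

text \<open>Brings reachability into the form of a duplicate-free list, as the cycle condition of
  \<open>is_tree\<close> requires.\<close>

lemma simple_path:
  assumes "(u, v) \<in> r\<^sup>*"
  obtains p where "p \<noteq> []" "hd p = u" "last p = v" "distinct p" "successively (\<lambda>x y. (x, y) \<in> r) p"
proof -
  have "\<exists>p. p \<noteq> [] \<and> hd p = u \<and> last p = v \<and> distinct p \<and> successively (\<lambda>x y. (x, y) \<in> r) p"
    using assms
  proof (induction rule: rtrancl_induct)
    case base
    show ?case by (rule exI[of _ "[u]"]) simp
  next
    case (step v w)
    then obtain p where p: "p \<noteq> []" "hd p = u" "last p = v" "distinct p"
      "successively (\<lambda>x y. (x, y) \<in> r) p" by blast
    show ?case
    proof (cases "w \<in> set p")
      case True
      \<comment> \<open>The path has already visited \<open>w\<close>, so it is cut there.\<close>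
      then obtain xs ys where "p = xs @ w # ys" by (meson split_list)
      with p show ?thesis
        by (intro exI[of _ "xs @ [w]"]) (auto simp: successively_append_iff hd_append)
    next
      case False
      with p step.hyps(2) show ?thesis
        by (intro exI[of _ "p @ [w]"]) (auto simp: successively_append_iff)
    qed
  qed
  then show ?thesis using that by blast
qed

lemma successively_set:
  assumes "successively (\<lambda>x y. (x, y) \<in> r) p" "length p \<ge> 2" "r \<subseteq> S \<times> S"
  shows "set p \<subseteq> S"
proof
  fix x assume "x \<in> set p"
  then obtain i where i: "i < length p" "x = p ! i" by (metis in_set_conv_nth)
  show "x \<in> S"
  proof (cases "Suc i < length p")
    case True
    then have "(p ! i, p ! Suc i) \<in> r"
      using assms(1) by (simp add: successively_conv_nth)
    with assms(3) i show ?thesis by blast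
  next
    case False
    \<comment> \<open>The last entry has no successor, but the length bound gives it a
      predecessor.\<close>
    then have "Suc (i - 1) = i" using i assms(2) by simp
    then have "(p ! (i - 1), p ! i) \<in> r"
      using assms(1) i by (metis successively_conv_nth)
    with assms(3) i show ?thesis by blast
  qed
qed

lemma rtrancl_exit:
  assumes "(u, v) \<in> r\<^sup>*" "u \<in> S" "v \<notin> S"
  obtains x y where "(x, y) \<in> r" "x \<in> S" "y \<notin> S"
  using assms by (induction rule: rtrancl_induct) blast+

text \<open>Two different neighbours of \<open>j\<close> in \<open>S\<close>, joined by a path
  inside \<open>S\<close>, would close a cycle through \<open>j\<close>.\<close>

lemma tree_unique_neighbour:
  assumes tree: "is_tree N E" and S: "connected_in E S" and j: "j \<notin> S"
    and i: "i \<in> S" "(i, j) \<in> E" and i': "i' \<in> S" "(i', j) \<in> E"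
  shows "i = i'"
proof (rule ccontr)
  assume neq: "i \<noteq> i'"
  have "(i, i') \<in> (E \<inter> S \<times> S)\<^sup>*"
    using S i(1) i'(1) unfolding connected_in_def by blast
  then obtain p where p: "p \<noteq> []" "hd p = i" "last p = i'" "distinct p"
    "successively (\<lambda>x y. (x, y) \<in> E \<inter> S \<times> S) p"
    by (rule simple_path)
  \<comment> \<open>Together with \<open>j\<close> this gives the three nodes that a cycle must
    have.\<close>
  have len: "length p \<ge> 2"
    using p(1-3) neq by (cases p; cases "tl p") auto
  have "set p \<subseteq> S"
    using successively_set[OF p(5) len] by blast
  moreover have "successively (\<lambda>x y. (x, y) \<in> E) p"
    using p(5) by (rule successively_mono) simp
  moreover have "(j, i) \<in> E"
    using tree i(2) unfolding is_tree_def by (meson symD)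
  ultimately have "length (j # p) \<ge> 3 \<and> distinct (j # p) \<and>
      successively (\<lambda>u v. (u, v) \<in> E) (j # p) \<and> (last (j # p), hd (j # p)) \<in> E"
    using len p j i'(2) by (auto simp: successively_Cons)
  then show False
    using tree unfolding is_tree_def by blast
qed

text \<open>Choices are made on a connected set that grows by one adjacent node at a time. The new
  node has exactly one neighbour in the set, so \<open>step\<close> has to meet only one constraint;
  \<open>sym\<close> handles the opposite orientation of the edge.\<close>

lemma tree_choice:
  fixes P :: "'n \<Rightarrow> 'c \<Rightarrow> bool" and Q :: "'c \<Rightarrow> 'c \<Rightarrow> bool"
  assumes tree: "is_tree N E" and start: "\<And>i. i \<in> N \<Longrightarrow> \<exists>c. P i c"
    and step: "\<And>i j c. (i, j) \<in> E \<Longrightarrow> P i c \<Longrightarrow> \<exists>d. P j d \<and> Q c d"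
    and sym: "\<And>c d. Q c d \<Longrightarrow> Q d c"
  shows "\<exists>\<phi>. (\<forall>i\<in>N. P i (\<phi> i)) \<and> (\<forall>(i, j)\<in>E. Q (\<phi> i) (\<phi> j))"
proof -
  have N: "finite N" "N \<noteq> {}" "E \<subseteq> N \<times> N" "sym E" "irrefl E"
    and conn: "\<And>u v. u \<in> N \<Longrightarrow> v \<in> N \<Longrightarrow> (u, v) \<in> E\<^sup>*"
    using tree unfolding is_tree_def by auto
  have "\<exists>S \<phi>. S \<subseteq> N \<and> card S = Suc n \<and> connected_in E S \<and> (\<forall>i\<in>S. P i (\<phi> i)) \<and>
      (\<forall>i\<in>S. \<forall>j\<in>S. (i, j) \<in> E \<longrightarrow> Q (\<phi> i) (\<phi> j))" if "Suc n \<le> card N" for n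
    using that
  proof (induction n)
    case 0
    obtain i where i: "i \<in> N" using N(2) by blast
    then obtain c where "P i c" using start by blast
    with i show ?case
      using N(5) by (intro exI[of _ "{i}"] exI[of _ "\<lambda>_. c"]) (auto simp: connected_in_def irrefl_def)
  next
    case (Suc n)
    then have "Suc n \<le> card N" by simp
    from Suc.IH[OF this] obtain S \<phi> where S: "S \<subseteq> N" "card S = Suc n" "connected_in E S"
      and P: "\<forall>i\<in>S. P i (\<phi> i)" and Q: "\<forall>i\<in>S. \<forall>j\<in>S. (i, j) \<in> E \<longrightarrow> Q (\<phi> i) (\<phi> j)"
      by blast
    note P = P[rule_format] and Q = Q[rule_format]
    obtain u where u: "u \<in> S" using S(2) by fastforce
    obtain v where v: "v \<in> N" "v \<notin> S"
      using S(1,2) Suc.prems by (metis Suc_n_not_le_n subset_antisym subsetI)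
    \<comment> \<open>A path from inside \<open>S\<close> to a node outside must cross the boundary,
      which yields the edge to extend along.\<close>
    have "(u, v) \<in> E\<^sup>*" using conn u v S(1) by blast
    then obtain i j where ij: "(i, j) \<in> E" "i \<in> S" "j \<notin> S"
      using rtrancl_exit[OF _ u v(2)] by blast
    have ji: "(j, i) \<in> E" using ij(1) N(4) by (meson symD)
    obtain d where d: "P j d" "Q (\<phi> i) d"
      using step[OF ij(1) P[OF ij(2)]] by blast
    let ?\<phi> = "\<phi>(j := d)"
    have uniq: "i' = i" if "i' \<in> S" "(i', j) \<in> E" for i'
      using tree_unique_neighbour[OF tree S(3) ij(3) that ij(2,1)] .
    have uniq': "i' = i" if "i' \<in> S" "(j, i') \<in> E" for i'
      using uniq[OF that(1)] that(2) N(4) by (meson symD)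
    have "connected_in E (insert j S)"
      unfolding connected_in_def
    proof (intro ballI)
      fix x y assume xy: "x \<in> insert j S" "y \<in> insert j S"
      let ?r = "E \<inter> insert j S \<times> insert j S"
      have inS: "(a, b) \<in> ?r\<^sup>*" if "a \<in> S" "b \<in> S" for a b
      proof -
        have "(a, b) \<in> (E \<inter> S \<times> S)\<^sup>*"
          using S(3) that unfolding connected_in_def by blast
        then show ?thesis by (rule rtrancl_mono[THEN subsetD, rotated]) blast
      qed
      have step: "(i, j) \<in> ?r" "(j, i) \<in> ?r"
        using ij ji by auto
      consider "x \<in> S" "y \<in> S" | "x = j" "y = j" | "x = j" "y \<in> S" | "x \<in> S" "y = j"
        using xy by blast
      then show "(x, y) \<in> ?r\<^sup>*"
      proof cases
        case 1
        then show ?thesis by (rule inS)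
      next
        case 2
        then show ?thesis by simp
      next
        case 3
        then show ?thesis
          using converse_rtrancl_into_rtrancl[OF step(2) inS[OF ij(2)]] by blast
      next
        case 4
        then show ?thesis
          using rtrancl_into_rtrancl[OF inS[OF _ ij(2)] step(1)] by blast
      qed
    qed
    moreover have "card (insert j S) = Suc (Suc n)"
      using S(1,2) ij(3) N(1) finite_subset by (metis card_insert_disjoint)
    moreover have "insert j S \<subseteq> N"
      using S(1) ij(1) N(3) by blast
    moreover have "\<forall>i\<in>insert j S. P i (?\<phi> i)"
      using P d(1) by simp
    moreover have "Q (?\<phi> a) (?\<phi> b)" if ab: "a \<in> insert j S" "b \<in> insert j S" "(a, b) \<in> E" for a b
    proof -
      have "a \<noteq> b" using ab(3) N(5) unfolding irrefl_def by blast
      then consider "a \<in> S" "b \<in> S" | "a = j" "b \<in> S" | "a \<in> S" "b = j"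
        using ab(1,2) by blast
      then show ?thesis
      proof cases
        case 1
        then have "a \<noteq> j" "b \<noteq> j" using ij(3) by auto
        with 1 show ?thesis using Q ab(3) by simp
      next
        case 2
        then have "b = i" "b \<noteq> j" using uniq' ab(3) ij(3) by auto
        with 2 show ?thesis using sym[OF d(2)] by simp
      next
        case 3
        then have "a = i" "a \<noteq> j" using uniq ab(3) ij(3) by auto
        with 3 show ?thesis using d(2) by simp
      qed
    qed
    ultimately show ?case by blast
  qed
  \<comment> \<open>With this \<open>n\<close> the connected set has as many nodes as the tree and
    is all of \<open>N\<close>.\<close>
  moreover have "Suc (card N - 1) = card N"
    using N(1,2) by (simp add: card_gt_0_iff)
  ultimately obtain S \<phi> where S: "S \<subseteq> N" "card S = card N"
    and \<phi>: "\<forall>i\<in>S. P i (\<phi> i)" "\<forall>i\<in>S. \<forall>j\<in>S. (i, j) \<in> E \<longrightarrow> Q (\<phi> i) (\<phi> j)"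
    by (metis order_refl)
  have "S = N" using S N(1) by (simp add: card_subset_eq)
  with \<phi> N(3) show ?thesis by blast
qed

section \<open>Covering the bags by k-unions\<close>

lemma k_unions_superset:
  assumes "U \<in> k_unions m \<sigma> A" "m \<le> k" "hyperedges \<sigma> A \<noteq> {}"
  obtains V where "V \<in> k_unions k \<sigma> A" "U \<subseteq> V"
proof -
  obtain es where es: "U = \<Union>(set es)" "length es = m" "set es \<subseteq> hyperedges \<sigma> A"
    using assms(1) unfolding k_unions_def by blast
  obtain e where e: "e \<in> hyperedges \<sigma> A" using assms(3) by blast
  \<comment> \<open>The hyperedges of a k-union may coincide, so copies of one hyperedge pad the
    list to length \<open>k\<close>; this is why some hyperedge must exist.\<close>
  let ?es = "es @ replicate (k - m) e"
  have "length ?es = k" "set ?es \<subseteq> hyperedges \<sigma> A"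
    using es e assms(2) by auto
  then have "\<Union>(set ?es) \<in> k_unions k \<sigma> A"
    unfolding k_unions_def by blast
  then show ?thesis using es(1) by (intro that) auto
qed

text \<open>The minimum in \<open>weight\<close> is attained because there is some cover, namely the
  union of all the finitely many hyperedges.\<close>

lemma weight_cover:
  assumes "finite_structure \<sigma> A"
  shows "\<exists>U\<in>k_unions (weight \<sigma> A X) \<sigma> A. X \<inter> \<Union>(hyperedges \<sigma> A) \<subseteq> U"
proof -
  have "hyperedges \<sigma> A \<subseteq> Pow (universe A)"
    using hyperedge_subset[OF assms] by blast
  then have "finite (hyperedges \<sigma> A)"
    using assms finite_subset unfolding finite_structure_def by blast
  then obtain es where "set es = hyperedges \<sigma> A"
    using finite_list by blast
  then have "\<Union>(hyperedges \<sigma> A) \<in> k_unions (length es) \<sigma> A"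
    unfolding k_unions_def by blast
  then have "\<exists>k. \<exists>U\<in>k_unions k \<sigma> A. X \<inter> \<Union>(hyperedges \<sigma> A) \<subseteq> U"
    by blast
  then show ?thesis
    unfolding weight_def by (rule LeastI_ex)
qed

lemma coverwidth_decomposition:
  assumes A: "finite_structure \<sigma> A" and k: "coverwidth \<sigma> A \<le> k" and "hyperedges \<sigma> A \<noteq> {}"
  obtains N :: "nat set" and E X Y where "tree_decomposition \<sigma> A N E X"
    "\<And>i. i \<in> N \<Longrightarrow> Y i \<in> k_unions k \<sigma> A \<and> X i \<inter> \<Union>(hyperedges \<sigma> A) \<subseteq> Y i"
proof -
  \<comment> \<open>The decomposition with a single bag shows that the minimum in
    \<open>coverwidth\<close> is attained.\<close>
  have "is_tree {0 :: nat} {}"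
    by (auto simp: is_tree_def irrefl_def sym_def)
  then have "tree_decomposition \<sigma> A {0 :: nat} {} (\<lambda>_. universe A)"
    using hyperedge_subset[OF A] by (auto simp: tree_decomposition_def connected_in_def)
  then have "\<exists>w. \<exists>(N :: nat set) E X.
      tree_decomposition \<sigma> A N E X \<and> decomposition_weight \<sigma> A N X = w"
    by blast
  then have "\<exists>(N :: nat set) E X.
      tree_decomposition \<sigma> A N E X \<and> decomposition_weight \<sigma> A N X = coverwidth \<sigma> A"
    unfolding coverwidth_def by (rule LeastI_ex)
  then obtain N :: "nat set" and E X where dec: "tree_decomposition \<sigma> A N E X"
    and w: "decomposition_weight \<sigma> A N X = coverwidth \<sigma> A"
    by blast
  have "\<exists>V. V \<in> k_unions k \<sigma> A \<and> X i \<inter> \<Union>(hyperedges \<sigma> A) \<subseteq> V" if i: "i \<in> N" for i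
  proof -
    have "finite N" using dec unfolding tree_decomposition_def is_tree_def by blast
    then have "weight \<sigma> A (X i) \<le> k"
      using Max_ge[of "(\<lambda>i. weight \<sigma> A (X i)) ` N" "weight \<sigma> A (X i)"] i w k
      unfolding decomposition_weight_def by simp
    moreover obtain U where U: "U \<in> k_unions (weight \<sigma> A (X i)) \<sigma> A"
      "X i \<inter> \<Union>(hyperedges \<sigma> A) \<subseteq> U"
      using weight_cover[OF A] by blast
    ultimately obtain V where "V \<in> k_unions k \<sigma> A" "U \<subseteq> V"
      using k_unions_superset assms(3) by metis
    with U(2) show ?thesis by blast
  qed
  then obtain Y where "\<And>i. i \<in> N \<Longrightarrow> Y i \<in> k_unions k \<sigma> A \<and> X i \<inter> \<Union>(hyperedges \<sigma> A) \<subseteq> Y i"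
    by metis
  with dec show ?thesis by (rule that)
qed

section \<open>Stable sets and homomorphisms\<close>

lemma satisfiable_of_stable:
  assumes inst: "csp_instance \<sigma> A B" and cw: "coverwidth \<sigma> A \<le> k" "hyperedges \<sigma> A \<noteq> {}"
    and M: "M \<subseteq> union_maps k \<sigma> A B" "stable k \<sigma> A M" "M \<noteq> {}"
  shows "satisfiable \<sigma> A B"
proof -
  have A: "finite_structure \<sigma> A" and B: "universe B \<noteq> {}"
    using inst unfolding csp_instance_def finite_structure_def by auto
  obtain N :: "nat set" and E X Y where dec: "tree_decomposition \<sigma> A N E X"
    and Y: "\<And>i. i \<in> N \<Longrightarrow> Y i \<in> k_unions k \<sigma> A \<and> X i \<inter> \<Union>(hyperedges \<sigma> A) \<subseteq> Y i"
    using coverwidth_decomposition[OF A cw] by metis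
  have tree: "is_tree N E" and E: "E \<subseteq> N \<times> N"
    using dec unfolding tree_decomposition_def is_tree_def by simp_all
  obtain f0 where f0: "f0 \<in> M" using M(3) by blast
  have "\<exists>\<phi>. (\<forall>i\<in>N. \<phi> i \<in> M \<and> dom (\<phi> i) = Y i) \<and> (\<forall>(i, j)\<in>E. compatible (\<phi> i) (\<phi> j))"
  proof (rule tree_choice[OF tree])
    show "\<exists>g. g \<in> M \<and> dom g = Y i" if "i \<in> N" for i
      using stableD[OF M(2) f0] Y[OF that] by blast
    show "\<exists>g. (g \<in> M \<and> dom g = Y j) \<and> compatible f g" if ij: "(i, j) \<in> E" and f: "f \<in> M \<and> dom f = Y i" for i j f
    proof -
      have "Y j \<in> k_unions k \<sigma> A" using Y ij E by blast
      from stableD[OF M(2) conjunct1[OF f] this] show ?thesis by blast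
    qed
    show "compatible g f" if "compatible f g" for f g :: "'b \<rightharpoonup> 'c"
      using that unfolding compatible_def by auto
  qed
  then obtain \<phi> where \<phi>: "\<And>i. i \<in> N \<Longrightarrow> \<phi> i \<in> M" "\<And>i. i \<in> N \<Longrightarrow> dom (\<phi> i) = Y i"
    and comp: "\<And>i j. (i, j) \<in> E \<Longrightarrow> compatible (\<phi> i) (\<phi> j)"
    by blast
  have proj: "projective_hom \<sigma> A B (\<phi> i)" if "i \<in> N" for i
    using \<phi>(1)[OF that] M(1) unfolding union_maps_def by blast
  let ?V = "\<Union>(hyperedges \<sigma> A)"
  \<comment> \<open>Along the path through the bags containing \<open>v\<close>, every k-union
    \<open>Y a\<close> contains \<open>v\<close> as well, so compatibility across each edge carries
    the value on.\<close>
  have agree: "\<phi> i v = \<phi> j v" if v: "v \<in> ?V" and i: "i \<in> N" "v \<in> X i" and j: "j \<in> N" "v \<in> X j" for i j v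
  proof -
    let ?S = "{i \<in> N. v \<in> X i}"
    have "v \<in> universe A" using v hyperedge_subset[OF A] by blast
    then have "(i, j) \<in> (E \<inter> ?S \<times> ?S)\<^sup>*"
      using dec i j unfolding tree_decomposition_def connected_in_def by blast
    then show ?thesis
    proof (induction rule: rtrancl_induct)
      case (step a b)
      then have "(a, b) \<in> E" "a \<in> N" "b \<in> N" "v \<in> Y a" "v \<in> Y b"
        using Y v by blast+
      then show ?case
        using comp[of a b] \<phi>(2) step.IH unfolding compatible_def by auto
    qed simp
  qed
  obtain b0 where b0: "b0 \<in> universe B" using B by blast
  \<comment> \<open>Vertices in no hyperedge are unconstrained and go to an arbitrary
    \<open>b0\<close>; for the others any bag containing the vertex may be consulted.\<close>
  define h where "h v = (if v \<in> ?V then the (\<phi> (SOME i. i \<in> N \<and> v \<in> X i) v) else b0)" for v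
  have h: "\<phi> i v = Some (h v)" if v: "v \<in> ?V" and i: "i \<in> N" "v \<in> X i" for i v
  proof -
    have "(SOME i. i \<in> N \<and> v \<in> X i) \<in> N \<and> v \<in> X (SOME i. i \<in> N \<and> v \<in> X i)"
      by (rule someI_ex) (use i in blast)
    then have "\<phi> (SOME i. i \<in> N \<and> v \<in> X i) v = \<phi> i v"
      using agree v i by blast
    moreover have "v \<in> dom (\<phi> i)"
      using \<phi>(2) Y v i by blast
    ultimately show ?thesis
      using v by (auto simp: h_def)
  qed
  have bag: "\<exists>i\<in>N. e \<subseteq> X i" if "e \<in> hyperedges \<sigma> A" for e
    using dec that unfolding tree_decomposition_def by blast
  have "homomorphism \<sigma> A B h"
    unfolding homomorphism_def
  proof (intro conjI ballI)
    have "h v \<in> universe B" for v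
    proof (cases "v \<in> ?V")
      case True
      then obtain i where i: "i \<in> N" "v \<in> X i" using bag by blast
      then have "h v \<in> ran (\<phi> i)"
        using h[OF True i] by (meson ranI)
      then show ?thesis
        using proj[OF i(1)] unfolding projective_hom_def by blast
    next
      case False
      then show ?thesis using b0 by (simp add: h_def)
    qed
    then show "h ` universe A \<subseteq> universe B" by blast
    fix R t assume R: "R \<in> symbols \<sigma>" and t: "t \<in> rel A R"
    have e: "set t \<in> hyperedges \<sigma> A"
      using R t unfolding hyperedges_def by blast
    then obtain i where i: "i \<in> N" "set t \<subseteq> X i" using bag by blast
    have val: "\<phi> i (t ! l) = Some (h (t ! l))" if "l < length t" for l
      using h[OF _ i(1)] that e i(2) nth_mem by blast
    from proj[OF i(1)] R t obtain s where s: "s \<in> rel B R" "length s = length t"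
      "\<And>l. l < length t \<Longrightarrow> t ! l \<in> dom (\<phi> i) \<Longrightarrow> \<phi> i (t ! l) = Some (s ! l)"
      unfolding projective_hom_def by blast
    \<comment> \<open>All entries of \<open>t\<close> lie in the domain of \<open>\<phi> i\<close>,
      so the projective condition leaves no freedom and its witness is the full image.\<close>
    have "map h t = s"
      using s(2,3) val by (intro nth_equalityI) auto
    with s(1) show "map h t \<in> rel B R" by simp
  qed
  then show ?thesis unfolding satisfiable_def by blast
qed

lemma stable_of_satisfiable:
  fixes k :: nat
  assumes "finite_structure \<sigma> A" "homomorphism \<sigma> A B h"
  defines "M \<equiv> (\<lambda>U. (\<lambda>x. Some (h x)) |` U) ` k_unions k \<sigma> A"
  shows "M \<subseteq> union_maps k \<sigma> A B" "stable k \<sigma> A M"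
proof -
  show "M \<subseteq> union_maps k \<sigma> A B"
  proof
    fix f assume "f \<in> M"
    then obtain U where U: "U \<in> k_unions k \<sigma> A" and f: "f = (\<lambda>x. Some (h x)) |` U"
      unfolding M_def by blast
    have "U \<subseteq> universe A"
      using k_union_subset[OF assms(1) U] .
    then have "ran f \<subseteq> universe B"
      using assms(2) unfolding f homomorphism_def ran_def restrict_map_def by auto
    moreover have "\<exists>s\<in>rel B R. length s = length t \<and>
        (\<forall>i<length t. t ! i \<in> dom f \<longrightarrow> f (t ! i) = Some (s ! i))"
      if "R \<in> symbols \<sigma>" "t \<in> rel A R" for R t
      using assms(2) that unfolding homomorphism_def f
      by (intro bexI[of _ "map h t"]) auto
    ultimately show "f \<in> union_maps k \<sigma> A B"
      using U \<open>U \<subseteq> universe A\<close> unfolding union_maps_def projective_hom_def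
      by (auto simp: f)
  qed
  show "stable k \<sigma> A M"
    unfolding stable_def M_def by (auto simp: compatible_def)
qed

lemma remaining_maps_nonempty_iff:
  assumes "csp_instance \<sigma> A B" "hyperedges \<sigma> A \<noteq> {}" "coverwidth \<sigma> A \<le> k"
    and S: "pkc_final k \<sigma> A B S"
  shows "remaining_maps k \<sigma> A S \<noteq> {} \<longleftrightarrow> satisfiable \<sigma> A B"
proof
  have A: "finite_structure \<sigma> A"
    using assms(1) unfolding csp_instance_def by blast
  show "satisfiable \<sigma> A B" if "remaining_maps k \<sigma> A S \<noteq> {}"
    using satisfiable_of_stable[OF assms(1,3,2) remaining_maps_subset[OF A S]
        stable_remaining_maps[OF A S] that] .
  assume "satisfiable \<sigma> A B"
  then obtain h where "homomorphism \<sigma> A B h" unfolding satisfiable_def by blast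
  from stable_subset_remaining_maps[OF A S stable_of_satisfiable[OF A this]]
  have "(\<lambda>U. (\<lambda>x. Some (h x)) |` U) ` k_unions k \<sigma> A \<subseteq> remaining_maps k \<sigma> A S" .
  \<comment> \<open>The restrictions yield a nonempty set only if some k-union exists; padding the
    empty 0-union gives one.\<close>
  moreover have "{} \<in> k_unions 0 \<sigma> A"
    unfolding k_unions_def by simp
  then have "k_unions k \<sigma> A \<noteq> {}"
    using k_unions_superset[OF _ le0 assms(2)] by blast
  ultimately show "remaining_maps k \<sigma> A S \<noteq> {}" by blast
qed

section \<open>Correctness of the algorithm on lists\<close>

lemma set_appends: "set (appends k xs) = {concat ys | ys. length ys = k \<and> set ys \<subseteq> set xs}"
proof (induction k)
  case (Suc k)
  have "set (appends (Suc k) xs) = {x @ y | x y. x \<in> set xs \<and> y \<in> set (appends k xs)}"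
    by auto
  also have "\<dots> = {concat ys | ys. length ys = Suc k \<and> set ys \<subseteq> set xs}"
    unfolding Suc.IH length_Suc_conv
    by (auto 4 4 intro: exI[of _ "_ # _"])
  finally show ?case .
qed auto

text \<open>\<open>map_of\<close> sees only the first entry for a key; self-agreement makes all
  entries for that key equal to it.\<close>

lemma agree_self_iff:
  assumes "agree f f"
  shows "(x, y) \<in> set f \<longleftrightarrow> map_of f x = Some y"
proof
  assume xy: "(x, y) \<in> set f"
  then obtain z where z: "map_of f x = Some z"
    by (metis weak_map_of_SomeI)
  then have "(x, z) \<in> set f" by (rule map_of_SomeD)
  then show "map_of f x = Some y"
    using assms xy z unfolding agree_def by fastforce
qed (rule map_of_SomeD)

lemma agree_iff_compatible:
  assumes "agree f f" "agree g g"
  shows "agree f g \<longleftrightarrow> compatible (map_of f) (map_of g)"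
proof -
  have "agree f g \<longleftrightarrow> (\<forall>x y z. (x, y) \<in> set f \<longrightarrow> (x, z) \<in> set g \<longrightarrow> y = z)"
    unfolding agree_def by fastforce
  also have "\<dots> \<longleftrightarrow> compatible (map_of f) (map_of g)"
    unfolding agree_self_iff[OF assms(1)] agree_self_iff[OF assms(2)] compatible_def
  proof (intro iffI ballI allI impI)
    fix x assume *: "\<forall>x y z. map_of f x = Some y \<longrightarrow> map_of g x = Some z \<longrightarrow> y = z"
      and "x \<in> dom (map_of f) \<inter> dom (map_of g)"
    then obtain y z where "map_of f x = Some y" "map_of g x = Some z" by blast
    with * show "map_of f x = map_of g x" by simp
  next
    fix x y z assume *: "\<forall>x\<in>dom (map_of f) \<inter> dom (map_of g). map_of f x = map_of g x"
      and yz: "map_of f x = Some y" "map_of g x = Some z"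
    then have "x \<in> dom (map_of f) \<inter> dom (map_of g)" by blast
    with * have "map_of f x = map_of g x" by blast
    with yz show "y = z" by simp
  qed
  finally show ?thesis .
qed

lemma agree_zip:
  assumes "agree f f" "length s = length t"
  shows "agree f (zip t s) \<longleftrightarrow>
    (\<forall>i<length t. t ! i \<in> dom (map_of f) \<longrightarrow> map_of f (t ! i) = Some (s ! i))"
proof -
  have "agree f (zip t s) \<longleftrightarrow> (\<forall>x y. (x, y) \<in> set f \<longrightarrow> (\<forall>i<length t. x = t ! i \<longrightarrow> y = s ! i))"
    unfolding agree_def using assms(2) by (fastforce simp: set_zip)
  also have "\<dots> \<longleftrightarrow> (\<forall>i<length t. t ! i \<in> dom (map_of f) \<longrightarrow> map_of f (t ! i) = Some (s ! i))"
    unfolding agree_self_iff[OF assms(1)] by auto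
  finally show ?thesis .
qed

lemma covers_iff: "covers g u \<longleftrightarrow> dom (map_of g) = set u"
proof -
  have "(\<exists>p\<in>set g. fst p = v) \<longleftrightarrow> v \<in> fst ` set g" for v
    by (metis image_iff)
  then show ?thesis
    unfolding covers_def dom_map_of_conv_image_fst by auto
qed

lemma foldl_const: "foldl (\<lambda>a _. F a) a xs = (F ^^ length xs) a"
  by (induction xs arbitrary: a) (simp_all add: funpow_swap1)

text \<open>Every application before the fixpoint shortens the list, so any bound on its length is a
  sufficient number of rounds.\<close>

lemma funpow_filter_fixpoint:
  assumes "\<And>L. length (F L) < length L \<or> F L = L" "length L \<le> n"
  shows "F ((F ^^ n) L) = (F ^^ n) L"
  using assms(2)
proof (induction n arbitrary: L)
  case 0
  then show ?case using assms(1)[of L] by simp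
next
  case (Suc n)
  show ?case
  proof (cases "F L = L")
    case True
    then have "(F ^^ m) L = L" for m by (induction m) simp_all
    with True show ?thesis by simp
  next
    case False
    then have "length (F L) \<le> n" using assms(1)[of L] Suc.prems by simp
    from Suc.IH[OF this] show ?thesis by (simp add: funpow_swap1)
  qed
qed

lemma length_filter_less_or_eq: "length (filter P xs) < length xs \<or> filter P xs = xs"
  by (induction xs) (auto simp: less_Suc_eq_le)

lemma prune_fixpoint: "prune (appends k (edge_lists rs)) (consistency k rs) = consistency k rs"
proof -
  let ?us = "appends k (edge_lists rs)"
  have "length (prune ?us L) < length L \<or> prune ?us L = L" for L
    unfolding prune_def by (rule length_filter_less_or_eq)
  then show ?thesis
    unfolding consistency_def foldl_const by (rule funpow_filter_fixpoint) simp
qed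

lemma prune_subset: "set (prune us L) \<subseteq> set L"
  by (auto simp: prune_def)

section \<open>The list version against the structures of an input\<close>

locale valid_input =
  fixes as bs :: "nat list" and rs :: relations and k :: nat
    and \<sigma> :: "nat signature" and A B :: "(nat, nat) rel_structure"
  defines "\<sigma> \<equiv> input_signature (as, bs, rs)"
    and "A \<equiv> input_left (as, bs, rs)" and "B \<equiv> input_right (as, bs, rs)"
  assumes valid: "(as, bs, rs) \<in> csp_inputs"
begin

lemma finite_A: "finite_structure \<sigma> A"
  and finite_B: "finite_structure \<sigma> B"
  using valid unfolding csp_inputs_def csp_instance_def \<sigma>_def A_def B_def by simp_all

lemma tuples:
  assumes "r \<in> set rs"
  shows "t \<in> set (fst (snd r)) \<Longrightarrow> length t = fst r \<and> set t \<subseteq> universe A"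
    and "s \<in> set (snd (snd r)) \<Longrightarrow> length s = fst r \<and> set s \<subseteq> universe B"
proof -
  obtain i where "i < length rs" "r = rs ! i" using assms by (metis in_set_conv_nth)
  then show "t \<in> set (fst (snd r)) \<Longrightarrow> length t = fst r \<and> set t \<subseteq> universe A"
    and "s \<in> set (snd (snd r)) \<Longrightarrow> length s = fst r \<and> set s \<subseteq> universe B"
    using finite_A finite_B unfolding finite_structure_def \<sigma>_def A_def B_def by simp_all
qed

text \<open>Passes from symbols as positions to the entries of \<open>rs\<close>. The predicate
  \<open>P\<close> is kept general to serve for hyperedges as well as for the projective
  condition.\<close>

lemma ball_symbols:
  "(\<forall>R\<in>symbols \<sigma>. \<forall>t\<in>rel A R. P t (rel B R)) \<longleftrightarrow>
    (\<forall>r\<in>set rs. \<forall>t\<in>set (fst (snd r)). P t (set (snd (snd r))))"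
  unfolding \<sigma>_def A_def B_def all_set_conv_all_nth[of rs] by auto

lemma hyperedges_eq: "hyperedges \<sigma> A = set ` set (edge_lists rs)"
proof -
  have "e \<in> hyperedges \<sigma> A \<longleftrightarrow> e \<in> set ` set (edge_lists rs)" for e
    \<comment> \<open>Being a hyperedge is existential, so the transfer is applied to the
      negation.\<close>
    using ball_symbols[of "\<lambda>t _. e \<noteq> set t"] unfolding hyperedges_def edge_lists_def by auto
  then show ?thesis by blast
qed

lemma k_unions_eq: "k_unions k \<sigma> A = set ` set (appends k (edge_lists rs))"
proof
  show "k_unions k \<sigma> A \<subseteq> set ` set (appends k (edge_lists rs))"
  proof
    fix U assume "U \<in> k_unions k \<sigma> A"
    then obtain es where es: "U = \<Union>(set es)" "length es = k" "set es \<subseteq> set ` set (edge_lists rs)"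
      unfolding k_unions_def hyperedges_eq by blast
    have "es \<in> lists (set ` set (edge_lists rs))"
      using es(3) by auto
    then obtain ys where "es = map set ys" "set ys \<subseteq> set (edge_lists rs)"
      unfolding lists_image by (auto simp: lists_eq_set)
    with es show "U \<in> set ` set (appends k (edge_lists rs))"
      unfolding set_appends by (intro image_eqI[of _ _ "concat ys"]) auto
  qed
  show "set ` set (appends k (edge_lists rs)) \<subseteq> k_unions k \<sigma> A"
  proof
    fix U assume "U \<in> set ` set (appends k (edge_lists rs))"
    then obtain ys where "U = set (concat ys)" "length ys = k" "set ys \<subseteq> set (edge_lists rs)"
      unfolding set_appends by blast
    then show "U \<in> k_unions k \<sigma> A"
      unfolding k_unions_def hyperedges_eq by (intro CollectI exI[of _ "map set ys"]) auto
  qed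
qed

lemma projective_iff:
  assumes "agree f f"
  shows "projective rs f \<longleftrightarrow> (\<forall>R\<in>symbols \<sigma>. \<forall>t\<in>rel A R. \<exists>s\<in>rel B R. length s = length t \<and>
    (\<forall>i<length t. t ! i \<in> dom (map_of f) \<longrightarrow> map_of f (t ! i) = Some (s ! i)))"
proof -
  have "agree f (zip t s) \<longleftrightarrow> length s = length t \<and>
    (\<forall>i<length t. t ! i \<in> dom (map_of f) \<longrightarrow> map_of f (t ! i) = Some (s ! i))"
    if "r \<in> set rs" "t \<in> set (fst (snd r))" "s \<in> set (snd (snd r))" for r t s
    using agree_zip[OF assms, of s t] tuples[OF that(1)] that(2,3) by simp
  then have "projective rs f \<longleftrightarrow> (\<forall>r\<in>set rs. \<forall>t\<in>set (fst (snd r)). \<exists>s\<in>set (snd (snd r)).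
      length s = length t \<and>
      (\<forall>i<length t. t ! i \<in> dom (map_of f) \<longrightarrow> map_of f (t ! i) = Some (s ! i)))"
    unfolding projective_def by (intro ball_cong bex_cong refl) simp
  then show ?thesis
    unfolding ball_symbols[of "\<lambda>t T. \<exists>s\<in>T. length s = length t \<and>
      (\<forall>i<length t. t ! i \<in> dom (map_of f) \<longrightarrow> map_of f (t ! i) = Some (s ! i))"] .
qed

lemma tuple_pairs_iff:
  "p \<in> set (tuple_pairs rs) \<longleftrightarrow>
    (\<exists>r\<in>set rs. \<exists>t\<in>set (fst (snd r)). \<exists>s\<in>set (snd (snd r)). p = zip t s)"
  by (auto simp: tuple_pairs_def)

lemma tuple_pair:
  assumes "p \<in> set (tuple_pairs rs)"
  shows "fst ` set p \<in> hyperedges \<sigma> A" "snd ` set p \<subseteq> universe B"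
proof -
  obtain r t s where r: "r \<in> set rs" "t \<in> set (fst (snd r))" "s \<in> set (snd (snd r))"
    and p: "p = zip t s"
    using assms unfolding tuple_pairs_iff by blast
  have len: "length t = length s" and s: "set s \<subseteq> universe B"
    using tuples[OF r(1)] r(2,3) by auto
  have "fst ` set p = set t" "snd ` set p = set s"
    using len unfolding p set_map[symmetric] by (simp_all add: map_fst_zip map_snd_zip)
  moreover have "t \<in> set (edge_lists rs)"
    using r by (auto simp: edge_lists_def)
  ultimately show "fst ` set p \<in> hyperedges \<sigma> A" "snd ` set p \<subseteq> universe B"
    using s unfolding hyperedges_eq by auto
qed

lemma initial_maps_agree: "f \<in> set (initial_maps k rs) \<Longrightarrow> agree f f"
  by (simp add: initial_maps_def)

lemma initial_maps_eq: "map_of ` set (initial_maps k rs) = union_maps k \<sigma> A B"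
proof
  show "map_of ` set (initial_maps k rs) \<subseteq> union_maps k \<sigma> A B"
  proof
    fix h assume "h \<in> map_of ` set (initial_maps k rs)"
    then obtain f where h: "h = map_of f" and f: "agree f f" "projective rs f"
      and "f \<in> set (appends k (tuple_pairs rs))"
      unfolding initial_maps_def by auto
    then obtain ps where ps: "f = concat ps" "length ps = k" "set ps \<subseteq> set (tuple_pairs rs)"
      unfolding set_appends by blast
    have "dom h = \<Union>(set (map (\<lambda>p. fst ` set p) ps))"
      unfolding h dom_map_of_conv_image_fst ps(1) by auto
    moreover have "set (map (\<lambda>p. fst ` set p) ps) \<subseteq> hyperedges \<sigma> A"
      using tuple_pair(1) ps(3) by auto
    ultimately have dom: "dom h \<in> k_unions k \<sigma> A"
      using ps(2) unfolding k_unions_def by (metis (mono_tags, lifting) length_map mem_Collect_eq)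
    have "snd ` set f \<subseteq> universe B"
      using tuple_pair(2) ps(3) unfolding ps(1) by fastforce
    then have "ran h \<subseteq> universe B"
      unfolding h ran_def by (force dest: map_of_SomeD)
    moreover have "dom h \<subseteq> universe A"
      using k_union_subset[OF finite_A dom] .
    ultimately show "h \<in> union_maps k \<sigma> A B"
      using f dom projective_iff[OF f(1)] unfolding h union_maps_def projective_hom_def by simp
  qed
  show "union_maps k \<sigma> A B \<subseteq> map_of ` set (initial_maps k rs)"
  proof
    fix h assume h: "h \<in> union_maps k \<sigma> A B"
    then obtain es where es: "dom h = \<Union>(set es)" "length es = k" "set es \<subseteq> hyperedges \<sigma> A"
      unfolding union_maps_def k_unions_def by blast
    have hom: "\<forall>r\<in>set rs. \<forall>t\<in>set (fst (snd r)). \<exists>s\<in>set (snd (snd r)). length s = length t \<and>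
        (\<forall>i<length t. t ! i \<in> dom h \<longrightarrow> h (t ! i) = Some (s ! i))"
    proof -
      have "projective_hom \<sigma> A B h"
        using h unfolding union_maps_def by simp
      from this[unfolded projective_hom_def, THEN conjunct2, THEN conjunct2] show ?thesis
        unfolding ball_symbols[of "\<lambda>t T. \<exists>s\<in>T. length s = length t \<and>
          (\<forall>i<length t. t ! i \<in> dom h \<longrightarrow> h (t ! i) = Some (s ! i))"] .
    qed
    have "\<exists>p\<in>set (tuple_pairs rs). set p = {(x, y). x \<in> e \<and> h x = Some y}" if e: "e \<in> set es" for e
    proof -
      obtain t where t: "t \<in> set (edge_lists rs)" "e = set t"
        using e es(3) unfolding hyperedges_eq by blast
      then obtain r where r: "r \<in> set rs" "t \<in> set (fst (snd r))"
        unfolding edge_lists_def by auto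
      with hom obtain s where s: "s \<in> set (snd (snd r))" "length s = length t"
        and val: "\<And>i. i < length t \<Longrightarrow> t ! i \<in> dom h \<Longrightarrow> h (t ! i) = Some (s ! i)"
        by meson
      \<comment> \<open>The hyperedge lies inside the domain, so \<open>s\<close> is forced to be
        the image of \<open>t\<close>, and \<open>zip t s\<close> lists the part of \<open>h\<close>
        over it.\<close>
      have "set t \<subseteq> dom h" using es(1) e t(2) by blast
      then have val': "h (t ! i) = Some (s ! i)" if "i < length t" for i
        using val[OF that] that nth_mem by blast
      have "set (zip t s) = {(x, y). x \<in> e \<and> h x = Some y}"
        unfolding t(2) using s(2) val' by (auto simp: set_zip in_set_conv_nth)
      moreover have "zip t s \<in> set (tuple_pairs rs)"
        unfolding tuple_pairs_iff using r s(1) by blast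
      ultimately show ?thesis by blast
    qed
    then have "\<forall>e\<in>set es. \<exists>p. p \<in> set (tuple_pairs rs) \<and> set p = {(x, y). x \<in> e \<and> h x = Some y}"
      by (simp add: Bex_def)
    from bchoice[OF this] obtain p where p: "\<forall>e\<in>set es.
        p e \<in> set (tuple_pairs rs) \<and> set (p e) = {(x, y). x \<in> e \<and> h x = Some y}"
      by (rule exE)
    \<comment> \<open>Hyperedges may overlap and keys repeat, but all pieces are parts of
      \<open>h\<close>, so the concatenation lists the graph of \<open>h\<close>.\<close>
    let ?f = "concat (map p es)"
    have set_f: "set ?f = {(x, y). h x = Some y}"
    proof -
      have "(x, y) \<in> set ?f \<longleftrightarrow> (\<exists>e\<in>set es. x \<in> e) \<and> h x = Some y" for x y
        using p by simp
      moreover have "\<exists>e\<in>set es. x \<in> e" if "h x = Some y" for x y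
        using domI[of h x y, OF that] es(1) by simp
      ultimately have "(x, y) \<in> set ?f \<longleftrightarrow> h x = Some y" for x y
        by blast
      then show ?thesis by auto
    qed
    then have agree: "agree ?f ?f"
      unfolding agree_def by auto
    have map: "map_of ?f = h"
    proof
      fix x
      have "map_of ?f x = Some y \<longleftrightarrow> h x = Some y" for y
        unfolding agree_self_iff[OF agree, symmetric] set_f by simp
      then show "map_of ?f x = h x"
        by (metis not_Some_eq)
    qed
    have "?f \<in> set (appends k (tuple_pairs rs))"
      unfolding set_appends using es(2) p by (intro CollectI exI[of _ "map p es"]) auto
    moreover have "projective rs ?f"
      using h unfolding projective_iff[OF agree] map union_maps_def projective_hom_def by simp
    ultimately have "?f \<in> set (initial_maps k rs)"
      using agree by (simp add: initial_maps_def)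
    then show "h \<in> map_of ` set (initial_maps k rs)"
      using map by blast
  qed
qed

abbreviation "unions \<equiv> appends k (edge_lists rs)"

lemma prune_mem_iff:
  assumes L: "\<And>f. f \<in> set L \<Longrightarrow> agree f f"
  shows "f \<in> set (prune unions L) \<longleftrightarrow> f \<in> set L \<and>
    (\<forall>U\<in>k_unions k \<sigma> A. \<exists>g\<in>map_of ` set L. dom g = U \<and> compatible (map_of f) g)"
proof (cases "f \<in> set L")
  case True
  have "agree f g \<longleftrightarrow> compatible (map_of f) (map_of g)" if "g \<in> set L" for g
    using agree_iff_compatible[OF L[OF True] L[OF that]] .
  with True show ?thesis
    unfolding prune_def k_unions_eq covers_iff by (auto cong: bex_cong)
qed (simp add: prune_def)

lemma stable_subset_prune:
  assumes L: "\<And>f. f \<in> set L \<Longrightarrow> agree f f" and M: "stable k \<sigma> A M" "M \<subseteq> map_of ` set L"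
  shows "M \<subseteq> map_of ` set (prune unions L)"
proof
  fix h assume h: "h \<in> M"
  then obtain f where f: "f \<in> set L" "h = map_of f" using M(2) by blast
  have "\<forall>U\<in>k_unions k \<sigma> A. \<exists>g\<in>map_of ` set L. dom g = U \<and> compatible (map_of f) g"
    using stableD[OF M(1) h] M(2) f(2) by blast
  with f(1) have "f \<in> set (prune unions L)"
    by (simp only: prune_mem_iff[of L f, OF L] simp_thms)
  then show "h \<in> map_of ` set (prune unions L)" using f(2) by blast
qed

lemma consistency_invariant:
  assumes M: "stable k \<sigma> A M" "M \<subseteq> union_maps k \<sigma> A B"
  shows "set (consistency k rs) \<subseteq> set (initial_maps k rs)" "M \<subseteq> map_of ` set (consistency k rs)"
proof -
  have "set ((prune unions ^^ n) (initial_maps k rs)) \<subseteq> set (initial_maps k rs) \<and>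
      M \<subseteq> map_of ` set ((prune unions ^^ n) (initial_maps k rs))" for n
  proof (induction n)
    case 0
    then show ?case using M(2) initial_maps_eq by simp
  next
    case (Suc n)
    let ?L = "(prune unions ^^ n) (initial_maps k rs)"
    have "agree f f" if "f \<in> set ?L" for f
      using that Suc.IH initial_maps_agree by blast
    from stable_subset_prune[OF this M(1)] show ?case
      using Suc.IH prune_subset[of unions ?L] by auto
  qed
  then show "set (consistency k rs) \<subseteq> set (initial_maps k rs)" "M \<subseteq> map_of ` set (consistency k rs)"
    unfolding consistency_def foldl_const by blast+
qed

text \<open>The result is stable because it is a fixpoint of \<open>prune\<close>, and it contains
  every stable set because no round deletes a member of one.\<close>

lemma consistency_eq:
  assumes S: "pkc_final k \<sigma> A B S"
  shows "map_of ` set (consistency k rs) = remaining_maps k \<sigma> A S"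
proof
  let ?L = "consistency k rs"
  note inv = consistency_invariant[OF stable_remaining_maps[OF finite_A S]
      remaining_maps_subset[OF finite_A S]]
  show "remaining_maps k \<sigma> A S \<subseteq> map_of ` set ?L" by (rule inv(2))
  have agree: "agree f f" if "f \<in> set ?L" for f
    using that inv(1) initial_maps_agree by blast
  have "\<forall>U\<in>k_unions k \<sigma> A. \<exists>g\<in>map_of ` set ?L. dom g = U \<and> compatible (map_of f) g"
    if "f \<in> set ?L" for f
    using that prune_mem_iff[of ?L f, OF agree] prune_fixpoint by simp
  then have "stable k \<sigma> A (map_of ` set ?L)"
    unfolding stable_def by blast
  moreover have "map_of ` set ?L \<subseteq> union_maps k \<sigma> A B"
    using inv(1) initial_maps_eq by blast
  ultimately show "map_of ` set ?L \<subseteq> remaining_maps k \<sigma> A S"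
    by (intro stable_subset_remaining_maps[OF finite_A S])
qed

end

section \<open>The program and the final equivalence\<close>

lemma consistency_tree_input:
  "consistency_tree k (right_child (right_child (enc_input (as, bs, rs)))) = enc_list enc_maps (consistency k rs)"
  by (simp add: enc_input_def consistency_tree_enc)

theorem theorem6:
  fixes k :: nat
    and \<sigma> :: "'s signature"
    and A :: "('s, 'a) rel_structure"
    and B :: "('s, 'b) rel_structure"
  assumes "k \<ge> 1"
  shows "(\<exists>c. executes_pkc k c \<and>
            polynomial_time_on c (enc_input ` csp_inputs) \<and>
            (\<forall>I\<in>csp_coverwidth_inputs k. accepts c (enc_input I) \<longleftrightarrow> input_satisfiable I)) \<and>
         (csp_instance \<sigma> A B \<and> hyperedges \<sigma> A \<noteq> {} \<and> coverwidth \<sigma> A \<le> k \<longrightarrow>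
            (reports_inconsistency k \<sigma> A B \<longleftrightarrow> \<not> satisfiable \<sigma> A B))"
proof (intro conjI impI)
  \<comment> \<open>Two right children skip the universes: k-unions and candidate maps are built
    from the tuples alone.\<close>
  obtain c and p :: "nat poly"
    where c: "\<And>x. \<exists>t \<le> poly p (size x). runs c x t (consistency_tree k (right_child (right_child x)))"
    using ptime_program[OF ptime_comp[OF ptime_consistency_tree ptime_right[OF ptime_right[OF ptime_id]]]]
    by blast
  have final: "\<exists>S. pkc_final k (input_signature I) (input_left I) (input_right I) S"
    if "I \<in> csp_inputs" for I
    using ex1_pkc_final that unfolding csp_inputs_def by blast
  have correct: "map_of ` set (consistency k (snd (snd I))) = remaining_maps k (input_signature I) (input_left I) S"
    if I: "I \<in> csp_inputs" and S: "pkc_final k (input_signature I) (input_left I) (input_right I) S" for I S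
  proof (cases I)
    case (fields as bs rs)
    interpret valid_input as bs rs k "input_signature I" "input_left I" "input_right I"
      using I by unfold_locales (simp_all add: fields)
    show ?thesis using consistency_eq[OF S] by (simp add: fields)
  qed
  have run: "\<exists>t \<le> poly p (size (enc_input I)). runs c (enc_input I) t (enc_list enc_maps (consistency k (snd (snd I))))" for I
    using c[of "enc_input I"] by (cases I) (simp add: consistency_tree_input)
  have "executes_pkc k c"
    unfolding executes_pkc_def using run final correct by meson
  moreover have "polynomial_time_on c (enc_input ` csp_inputs)"
    unfolding polynomial_time_on_def using c by blast
  moreover have "accepts c (enc_input I) \<longleftrightarrow> input_satisfiable I" if "I \<in> csp_coverwidth_inputs k" for I
  proof -
    have I: "I \<in> csp_inputs" and edges: "hyperedges (input_signature I) (input_left I) \<noteq> {}"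
      and cw: "coverwidth (input_signature I) (input_left I) \<le> k"
      using that unfolding csp_coverwidth_inputs_def by simp_all
    obtain S where S: "pkc_final k (input_signature I) (input_left I) (input_right I) S"
      using final[OF I] by blast
    obtain t where t: "runs c (enc_input I) t (enc_list enc_maps (consistency k (snd (snd I))))"
      using run by blast
    \<comment> \<open>By determinism every run yields this output, so acceptance depends on it
      alone.\<close>
    have "y = enc_list enc_maps (consistency k (snd (snd I)))" if "runs c (enc_input I) u y" for u y
      using that t exec_deterministic unfolding runs_def by blast
    then have "accepts c (enc_input I) \<longleftrightarrow> enc_list enc_maps (consistency k (snd (snd I))) \<noteq> Leaf"
      unfolding accepts_def using t by blast
    also have "\<dots> \<longleftrightarrow> remaining_maps k (input_signature I) (input_left I) S \<noteq> {}"
      using correct[OF I S] by auto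
    also have "\<dots> \<longleftrightarrow> input_satisfiable I"
      unfolding input_satisfiable_def
      by (rule remaining_maps_nonempty_iff[OF _ edges cw S]) (use I in \<open>simp add: csp_inputs_def\<close>)
    finally show ?thesis .
  qed
  ultimately show "\<exists>c. executes_pkc k c \<and> polynomial_time_on c (enc_input ` csp_inputs) \<and>
      (\<forall>I\<in>csp_coverwidth_inputs k. accepts c (enc_input I) \<longleftrightarrow> input_satisfiable I)"
    by blast
next
  assume inst: "csp_instance \<sigma> A B \<and> hyperedges \<sigma> A \<noteq> {} \<and> coverwidth \<sigma> A \<le> k"
  then obtain S where S: "pkc_final k \<sigma> A B S"
    using ex1_pkc_final by blast
  show "reports_inconsistency k \<sigma> A B \<longleftrightarrow> \<not> satisfiable \<sigma> A B"
    using reports_inconsistency_iff[OF _ S] remaining_maps_nonempty_iff[OF _ _ _ S] inst by blast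
qed

end
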